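(* Let $\mathcal{A}$ be a homological category and $(\mathcal{T},\mathcal{F})$ a torsion theory in $\mathcal{A}$, with reflector $F\colon\mathcal{A}\to\mathcal{F}$. Then the following conditions are equivalent: (1) the torsion subcategory $\mathcal{T}$ is $\mathcal{M}$-hereditary, for $\mathcal{M}$ the class of protosplit monomorphisms in $\mathcal{A}$; (2) the reflector $F\colon \mathcal{A}\to\mathcal{F}$ is protoadditive.
   Context: A category is pointed if it has a zero object $0$. A short exact sequence is a composable pair $(k,f)$ with $k=\ker(f)$ and $f=\mathrm{coker}(k)$. A split short exact sequence is a triple $(k,f,s)$ with $k=\ker(f)$ and $f\circ s=1$. A pointed category with pullbacks along split epimorphisms is protomodular if the split short five lemma holds: for any morphism $(\kappa,\alpha,\beta)$ of split short exact sequences, if $\kappa$ and $\beta$ are isomorphisms then so is $\alpha$. A homological category is a pointed protomodular category which is regular (finitely complete with pullback-stable (regular epi)-mono factorisations). A torsion theory in a pointed category $\mathcal{A}$ is a pair $(\mathcal{T},\mathcal{F})$ of full replete subcategories such that $\mathrm{Hom}_{\mathcal{A}}(T,F)=\{0\}$ for all $T\in\mathcal{T}$, $F\in\mathcal{F}$, and every object $A$ admits a short exact sequence $0\to T\to A\to F\to 0$ with $T\in\mathcal{T}$ and $F\in\mathcal{F}$. Then $\mathcal{F}$ is reflective in $\mathcal{A}$, the reflection of $A$ being $A\to F$ in this sequence; $\mathcal{T}$ is called the torsion subcategory. A functor between pointed protomodular categories is protoadditive if it preserves split short exact sequences. A protosplit monomorphism is a monomorphism that is the kernel of a split epimorphism.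 A subcategory $\mathcal{T}$ is $\mathcal{M}$-hereditary, for a class $\mathcal{M}$ of monomorphisms, if for every $m\colon A\to B$ in $\mathcal{M}$, $B\in\mathcal{T}$ implies $A\in\mathcal{T}$. *)

theory Defs
  imports Main
begin

section \<open>Categories and functors\<close>

record ('o, 'a) precategory =
  Obj :: "'o set"
  Arr :: "'a set"
  Dom :: "'a \<Rightarrow> 'o"
  Cod :: "'a \<Rightarrow> 'o"
  Id  :: "'o \<Rightarrow> 'a"
  Cmp :: "'a \<Rightarrow> 'a \<Rightarrow> 'a"  (infixr "\<cdot>\<index>" 70)

definition Hom :: "('o, 'a, 'x) precategory_scheme \<Rightarrow> 'o \<Rightarrow> 'o \<Rightarrow> 'a set" where
  "Hom C A B = {f \<in> Arr C. Dom C f = A \<and> Cod C f = B}"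

locale category =
  fixes C :: "('o, 'a, 'x) precategory_scheme" (structure)
  assumes Dom_in_Obj: "f \<in> Arr C \<Longrightarrow> Dom C f \<in> Obj C"
    and Cod_in_Obj: "f \<in> Arr C \<Longrightarrow> Cod C f \<in> Obj C"
    and Id_in_Hom: "A \<in> Obj C \<Longrightarrow> Id C A \<in> Hom C A A"
    and Cmp_in_Hom: "f \<in> Hom C A B \<Longrightarrow> g \<in> Hom C B D \<Longrightarrow> g \<cdot> f \<in> Hom C A D"
    and Cmp_Id_right: "f \<in> Hom C A B \<Longrightarrow> f \<cdot> Id C A = f"
    and Cmp_Id_left: "f \<in> Hom C A B \<Longrightarrow> Id C B \<cdot> f = f"
    and Cmp_assoc: "f \<in> Hom C A B \<Longrightarrow> g \<in> Hom C B D \<Longrightarrow> h \<in> Hom C D E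
                      \<Longrightarrow> (h \<cdot> g) \<cdot> f = h \<cdot> (g \<cdot> f)"

text \<open>A full subcategory is given by its set of objects.\<close>

definition full_subcategory ::
    "('o, 'a, 'x) precategory_scheme \<Rightarrow> 'o set \<Rightarrow> ('o, 'a, 'x) precategory_scheme" where
  "full_subcategory C S =
     C \<lparr>Obj := S, Arr := {f \<in> Arr C. Dom C f \<in> S \<and> Cod C f \<in> S}\<rparr>"

record ('o1, 'a1, 'o2, 'a2) prefunctor =
  FObj :: "'o1 \<Rightarrow> 'o2"
  FArr :: "'a1 \<Rightarrow> 'a2"

definition is_functor ::
    "('o1, 'a1, 'x) precategory_scheme \<Rightarrow> ('o2, 'a2, 'y) precategory_scheme
      \<Rightarrow> ('o1, 'a1, 'o2, 'a2) prefunctor \<Rightarrow> bool" where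
  "is_functor C D F \<longleftrightarrow>
     (\<forall>A \<in> Obj C. FObj F A \<in> Obj D) \<and>
     (\<forall>A B. \<forall>f \<in> Hom C A B. FArr F f \<in> Hom D (FObj F A) (FObj F B)) \<and>
     (\<forall>A \<in> Obj C. FArr F (Id C A) = Id D (FObj F A)) \<and>
     (\<forall>X Y Z. \<forall>f \<in> Hom C X Y. \<forall>g \<in> Hom C Y Z.
        FArr F (g \<cdot>\<^bsub>C\<^esub> f) = FArr F g \<cdot>\<^bsub>D\<^esub> FArr F f)"

section \<open>Kinds of morphisms\<close>

definition is_iso :: "('o, 'a, 'x) precategory_scheme \<Rightarrow> 'a \<Rightarrow> bool" where
  "is_iso C f \<longleftrightarrow> f \<in> Arr C \<and>
     (\<exists>g \<in> Hom C (Cod C f) (Dom C f).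
        g \<cdot>\<^bsub>C\<^esub> f = Id C (Dom C f) \<and> f \<cdot>\<^bsub>C\<^esub> g = Id C (Cod C f))"

definition is_mono :: "('o, 'a, 'x) precategory_scheme \<Rightarrow> 'a \<Rightarrow> bool" where
  "is_mono C m \<longleftrightarrow> m \<in> Arr C \<and>
     (\<forall>X. \<forall>f \<in> Hom C X (Dom C m). \<forall>g \<in> Hom C X (Dom C m).
        m \<cdot>\<^bsub>C\<^esub> f = m \<cdot>\<^bsub>C\<^esub> g \<longrightarrow> f = g)"

definition is_section_of :: "('o, 'a, 'x) precategory_scheme \<Rightarrow> 'a \<Rightarrow> 'a \<Rightarrow> bool" where
  "is_section_of C s f \<longleftrightarrow> f \<in> Arr C \<and> s \<in> Hom C (Cod C f) (Dom C f) \<and>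
     f \<cdot>\<^bsub>C\<^esub> s = Id C (Cod C f)"

definition is_split_epi :: "('o, 'a, 'x) precategory_scheme \<Rightarrow> 'a \<Rightarrow> bool" where
  "is_split_epi C f \<longleftrightarrow> (\<exists>s. is_section_of C s f)"

definition is_coequalizer ::
    "('o, 'a, 'x) precategory_scheme \<Rightarrow> 'a \<Rightarrow> 'a \<Rightarrow> 'a \<Rightarrow> bool" where
  "is_coequalizer C e u v \<longleftrightarrow>
     e \<in> Arr C \<and> u \<in> Arr C \<and> v \<in> Hom C (Dom C u) (Cod C u) \<and> Dom C e = Cod C u \<and>
     e \<cdot>\<^bsub>C\<^esub> u = e \<cdot>\<^bsub>C\<^esub> v \<and>
     (\<forall>X. \<forall>g \<in> Hom C (Dom C e) X. g \<cdot>\<^bsub>C\<^esub> u = g \<cdot>\<^bsub>C\<^esub> v \<longrightarrow>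
        (\<exists>!h. h \<in> Hom C (Cod C e) X \<and> h \<cdot>\<^bsub>C\<^esub> e = g))"

definition is_regular_epi :: "('o, 'a, 'x) precategory_scheme \<Rightarrow> 'a \<Rightarrow> bool" where
  "is_regular_epi C e \<longleftrightarrow> (\<exists>u v. is_coequalizer C e u v)"

section \<open>Finite limits and regularity\<close>

text \<open>In \<open>is_pullback C p q f g\<close>, \<open>p\<close> and \<open>q\<close> are the projections to the domains of \<open>f\<close>
  and \<open>g\<close> respectively; thus \<open>q\<close> is the pullback of \<open>f\<close> along \<open>g\<close>.\<close>

definition is_pullback ::
    "('o, 'a, 'x) precategory_scheme \<Rightarrow> 'a \<Rightarrow> 'a \<Rightarrow> 'a \<Rightarrow> 'a \<Rightarrow> bool" where
  "is_pullback C p q f g \<longleftrightarrow>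
     f \<in> Arr C \<and> g \<in> Arr C \<and> p \<in> Arr C \<and> q \<in> Arr C \<and>
     Cod C f = Cod C g \<and> Dom C p = Dom C q \<and> Cod C p = Dom C f \<and> Cod C q = Dom C g \<and>
     f \<cdot>\<^bsub>C\<^esub> p = g \<cdot>\<^bsub>C\<^esub> q \<and>
     (\<forall>X. \<forall>a \<in> Hom C X (Dom C f). \<forall>b \<in> Hom C X (Dom C g).
        f \<cdot>\<^bsub>C\<^esub> a = g \<cdot>\<^bsub>C\<^esub> b \<longrightarrow>
        (\<exists>!h. h \<in> Hom C X (Dom C p) \<and> p \<cdot>\<^bsub>C\<^esub> h = a \<and> q \<cdot>\<^bsub>C\<^esub> h = b))"

definition is_cone ::
    "('j, 'b, 'y) precategory_scheme \<Rightarrow> ('o, 'a, 'x) precategory_scheme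
      \<Rightarrow> ('j, 'b, 'o, 'a) prefunctor \<Rightarrow> 'o \<Rightarrow> ('j \<Rightarrow> 'a) \<Rightarrow> bool" where
  "is_cone J C D L \<pi> \<longleftrightarrow> L \<in> Obj C \<and>
     (\<forall>j \<in> Obj J. \<pi> j \<in> Hom C L (FObj D j)) \<and>
     (\<forall>i j. \<forall>u \<in> Hom J i j. FArr D u \<cdot>\<^bsub>C\<^esub> \<pi> i = \<pi> j)"

definition is_limit ::
    "('j, 'b, 'y) precategory_scheme \<Rightarrow> ('o, 'a, 'x) precategory_scheme
      \<Rightarrow> ('j, 'b, 'o, 'a) prefunctor \<Rightarrow> 'o \<Rightarrow> ('j \<Rightarrow> 'a) \<Rightarrow> bool" where
  "is_limit J C D L \<pi> \<longleftrightarrow> is_cone J C D L \<pi> \<and>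
     (\<forall>M \<mu>. is_cone J C D M \<mu> \<longrightarrow>
        (\<exists>!h. h \<in> Hom C M L \<and> (\<forall>j \<in> Obj J. \<pi> j \<cdot>\<^bsub>C\<^esub> h = \<mu> j)))"

text \<open>Every finite category is isomorphic to one whose objects and morphisms are natural
  numbers, so it is enough to consider index categories of that type.\<close>

definition finitely_complete :: "('o, 'a, 'x) precategory_scheme \<Rightarrow> bool" where
  "finitely_complete C \<longleftrightarrow>
     (\<forall>(J :: (nat, nat) precategory) D.
        category J \<and> finite (Obj J) \<and> finite (Arr J) \<and> is_functor J C D \<longrightarrow>
        (\<exists>L \<pi>. is_limit J C D L \<pi>))"

text \<open>In \<open>factorisations_stable\<close>, the factorisation \<open>m \<cdot> e\<close> is pulled back along \<open>g\<close>
  in two steps: \<open>m'\<close> is the pullback of \<open>m\<close> along \<open>g\<close>, and \<open>e'\<close> is the pullback of \<open>e\<close>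
  along the projection \<open>g'\<close> from the domain of \<open>m'\<close> to that of \<open>m\<close>.\<close>

locale regular_category = category C for C :: "('o, 'a, 'x) precategory_scheme" (structure) +
  assumes finitely_complete: "finitely_complete C"
    and factorisation: "f \<in> Arr C \<Longrightarrow>
      \<exists>m e. is_mono C m \<and> is_regular_epi C e \<and> Cod C e = Dom C m \<and> m \<cdot> e = f"
    and factorisations_stable:
      "\<lbrakk> is_mono C m; is_regular_epi C e; Cod C e = Dom C m;
         is_pullback C g' m' m g; is_pullback C g'' e' e g' \<rbrakk>
       \<Longrightarrow> is_mono C m' \<and> is_regular_epi C e'"

section \<open>Pointed categories and exact sequences\<close>

definition is_initial :: "('o, 'a, 'x) precategory_scheme \<Rightarrow> 'o \<Rightarrow> bool" where
  "is_initial C Z \<longleftrightarrow> Z \<in> Obj C \<and> (\<forall>A \<in> Obj C. \<exists>!f. f \<in> Hom C Z A)"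

definition is_terminal :: "('o, 'a, 'x) precategory_scheme \<Rightarrow> 'o \<Rightarrow> bool" where
  "is_terminal C Z \<longleftrightarrow> Z \<in> Obj C \<and> (\<forall>A \<in> Obj C. \<exists>!f. f \<in> Hom C A Z)"

definition is_zero_object :: "('o, 'a, 'x) precategory_scheme \<Rightarrow> 'o \<Rightarrow> bool" where
  "is_zero_object C Z \<longleftrightarrow> is_initial C Z \<and> is_terminal C Z"

definition is_zero_arrow :: "('o, 'a, 'x) precategory_scheme \<Rightarrow> 'a \<Rightarrow> bool" where
  "is_zero_arrow C f \<longleftrightarrow> f \<in> Arr C \<and>
     (\<exists>Z u v. is_zero_object C Z \<and> u \<in> Hom C (Dom C f) Z \<and> v \<in> Hom C Z (Cod C f) \<and>
        f = v \<cdot>\<^bsub>C\<^esub> u)"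

definition is_kernel :: "('o, 'a, 'x) precategory_scheme \<Rightarrow> 'a \<Rightarrow> 'a \<Rightarrow> bool" where
  "is_kernel C k f \<longleftrightarrow>
     k \<in> Arr C \<and> f \<in> Arr C \<and> Cod C k = Dom C f \<and> is_zero_arrow C (f \<cdot>\<^bsub>C\<^esub> k) \<and>
     (\<forall>X. \<forall>g \<in> Hom C X (Dom C f). is_zero_arrow C (f \<cdot>\<^bsub>C\<^esub> g) \<longrightarrow>
        (\<exists>!h. h \<in> Hom C X (Dom C k) \<and> k \<cdot>\<^bsub>C\<^esub> h = g))"

definition is_cokernel :: "('o, 'a, 'x) precategory_scheme \<Rightarrow> 'a \<Rightarrow> 'a \<Rightarrow> bool" where
  "is_cokernel C f k \<longleftrightarrow>
     k \<in> Arr C \<and> f \<in> Arr C \<and> Cod C k = Dom C f \<and> is_zero_arrow C (f \<cdot>\<^bsub>C\<^esub> k) \<and>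
     (\<forall>X. \<forall>g \<in> Hom C (Cod C k) X. is_zero_arrow C (g \<cdot>\<^bsub>C\<^esub> k) \<longrightarrow>
        (\<exists>!h. h \<in> Hom C (Cod C f) X \<and> h \<cdot>\<^bsub>C\<^esub> f = g))"

definition short_exact :: "('o, 'a, 'x) precategory_scheme \<Rightarrow> 'a \<Rightarrow> 'a \<Rightarrow> bool" where
  "short_exact C k f \<longleftrightarrow> is_kernel C k f \<and> is_cokernel C f k"

definition split_short_exact ::
    "('o, 'a, 'x) precategory_scheme \<Rightarrow> 'a \<Rightarrow> 'a \<Rightarrow> 'a \<Rightarrow> bool" where
  "split_short_exact C k f s \<longleftrightarrow> is_kernel C k f \<and> is_section_of C s f"

definition split_short_exact_morphism ::
    "('o, 'a, 'x) precategory_scheme \<Rightarrow> 'a \<times> 'a \<times> 'a \<Rightarrow> 'a \<times> 'a \<times> 'a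
      \<Rightarrow> 'a \<times> 'a \<times> 'a \<Rightarrow> bool" where
  "split_short_exact_morphism C = (\<lambda>(\<kappa>, \<alpha>, \<beta>) (k, f, s) (k', f', s').
     split_short_exact C k f s \<and> split_short_exact C k' f' s' \<and>
     \<kappa> \<in> Hom C (Dom C k) (Dom C k') \<and>
     \<alpha> \<in> Hom C (Dom C f) (Dom C f') \<and>
     \<beta> \<in> Hom C (Cod C f) (Cod C f') \<and>
     \<alpha> \<cdot>\<^bsub>C\<^esub> k = k' \<cdot>\<^bsub>C\<^esub> \<kappa> \<and>
     f' \<cdot>\<^bsub>C\<^esub> \<alpha> = \<beta> \<cdot>\<^bsub>C\<^esub> f \<and>
     \<alpha> \<cdot>\<^bsub>C\<^esub> s = s' \<cdot>\<^bsub>C\<^esub> \<beta>)"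

locale pointed_category = category C for C :: "('o, 'a, 'x) precategory_scheme" (structure) +
  assumes zero_object_exists: "\<exists>Z. is_zero_object C Z"

locale protomodular_category = pointed_category C
  for C :: "('o, 'a, 'x) precategory_scheme" (structure) +
  assumes split_epi_pullbacks:
      "\<lbrakk> is_split_epi C f; g \<in> Arr C; Cod C g = Cod C f \<rbrakk> \<Longrightarrow> \<exists>p q. is_pullback C p q f g"
    and split_short_five:
      "\<lbrakk> split_short_exact_morphism C (\<kappa>, \<alpha>, \<beta>) (k, f, s) (k', f', s');
         is_iso C \<kappa>; is_iso C \<beta> \<rbrakk> \<Longrightarrow> is_iso C \<alpha>"

locale homological_category = protomodular_category C + regular_category C
  for C :: "('o, 'a, 'x) precategory_scheme" (structure)

section \<open>Torsion theories\<close>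

definition replete :: "('o, 'a, 'x) precategory_scheme \<Rightarrow> 'o set \<Rightarrow> bool" where
  "replete C S \<longleftrightarrow> S \<subseteq> Obj C \<and>
     (\<forall>f. is_iso C f \<and> Dom C f \<in> S \<longrightarrow> Cod C f \<in> S)"

text \<open>In a pointed category every hom-set contains exactly one zero morphism, so the first
  clause after repleteness says that \<open>Hom C A B\<close> consists of the zero morphism alone.\<close>

definition torsion_theory ::
    "('o, 'a, 'x) precategory_scheme \<Rightarrow> 'o set \<Rightarrow> 'o set \<Rightarrow> bool" where
  "torsion_theory C \<T> \<F> \<longleftrightarrow> replete C \<T> \<and> replete C \<F> \<and>
     (\<forall>A \<in> \<T>. \<forall>B \<in> \<F>. \<forall>f \<in> Hom C A B. is_zero_arrow C f) \<and>
     (\<forall>A \<in> Obj C. \<exists>T \<in> \<T>. \<exists>F \<in> \<F>. \<exists>k \<in> Hom C T A. \<exists>f \<in> Hom C A F. short_exact C k f)"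

text \<open>A reflector is a left adjoint of the inclusion of a full subcategory, here described
  through the unit \<open>\<eta>\<close> of the adjunction and its universal property.\<close>

definition reflector ::
    "('o, 'a, 'x) precategory_scheme \<Rightarrow> 'o set \<Rightarrow> ('o, 'a, 'o, 'a) prefunctor \<Rightarrow> bool" where
  "reflector C S R \<longleftrightarrow> is_functor C (full_subcategory C S) R \<and>
     (\<exists>\<eta>. (\<forall>A \<in> Obj C. \<eta> A \<in> Hom C A (FObj R A)) \<and>
          (\<forall>A B. \<forall>f \<in> Hom C A B. FArr R f \<cdot>\<^bsub>C\<^esub> \<eta> A = \<eta> B \<cdot>\<^bsub>C\<^esub> f) \<and>
          (\<forall>A \<in> Obj C. \<forall>X \<in> S. \<forall>f \<in> Hom C A X.
             \<exists>!h. h \<in> Hom C (FObj R A) X \<and> h \<cdot>\<^bsub>C\<^esub> \<eta> A = f))"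

definition protoadditive ::
    "('o1, 'a1, 'x) precategory_scheme \<Rightarrow> ('o2, 'a2, 'y) precategory_scheme
      \<Rightarrow> ('o1, 'a1, 'o2, 'a2) prefunctor \<Rightarrow> bool" where
  "protoadditive C D F \<longleftrightarrow> (\<forall>k f s. split_short_exact C k f s \<longrightarrow>
     split_short_exact D (FArr F k) (FArr F f) (FArr F s))"

definition protosplit_monos :: "('o, 'a, 'x) precategory_scheme \<Rightarrow> 'a set" where
  "protosplit_monos C = {m. is_mono C m \<and> (\<exists>f. is_split_epi C f \<and> is_kernel C m f)}"

definition hereditary ::
    "('o, 'a, 'x) precategory_scheme \<Rightarrow> 'a set \<Rightarrow> 'o set \<Rightarrow> bool" where
  "hereditary C M S \<longleftrightarrow> (\<forall>m \<in> M. Cod C m \<in> S \<longrightarrow> Dom C m \<in> S)"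

text \<open>The torsion-free subcategory is reflective, the unit being given by the short exact
  sequences of the torsion theory. By uniqueness of adjoints, every reflector is of this form
  up to isomorphism.\<close>

lemma torsion_theory_reflective:
  assumes "category C" and tt: "torsion_theory C \<T> \<F>"
  shows "\<exists>R. reflector C \<F> R"
proof -
  interpret category C by fact
  have "\<forall>A. \<exists>X f. A \<in> Obj C \<longrightarrow> X \<in> \<F> \<and> f \<in> Hom C A X \<and>
     (\<forall>Y \<in> \<F>. \<forall>g \<in> Hom C A Y. \<exists>!h. h \<in> Hom C X Y \<and> h \<cdot>\<^bsub>C\<^esub> f = g)"
  proof
    fix A
    show "\<exists>X f. A \<in> Obj C \<longrightarrow> X \<in> \<F> \<and> f \<in> Hom C A X \<and>
     (\<forall>Y \<in> \<F>. \<forall>g \<in> Hom C A Y. \<exists>!h. h \<in> Hom C X Y \<and> h \<cdot>\<^bsub>C\<^esub> f = g)"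
    proof (cases "A \<in> Obj C")
      case True
      then obtain T X k f where *: "T \<in> \<T>" "X \<in> \<F>" "k \<in> Hom C T A" "f \<in> Hom C A X" "short_exact C k f"
        using tt unfolding torsion_theory_def by meson
      have "\<exists>!h. h \<in> Hom C X Y \<and> h \<cdot>\<^bsub>C\<^esub> f = g" if "Y \<in> \<F>" "g \<in> Hom C A Y" for Y g
      proof -
        have "is_zero_arrow C (g \<cdot>\<^bsub>C\<^esub> k)"
          using tt *(1,3) that Cmp_in_Hom[OF *(3) that(2)] unfolding torsion_theory_def by blast
        moreover have "is_cokernel C f k" using *(5) by (simp add: short_exact_def)
        moreover have "Cod C f = X" "Cod C k = A" using * by (auto simp: Hom_def)
        ultimately show ?thesis using that unfolding is_cokernel_def by blast
      qed
      with * show ?thesis by blast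
    qed auto
  qed
  then obtain X e where XF: "\<And>A. A \<in> Obj C \<Longrightarrow> X A \<in> \<F>"
    and e: "\<And>A. A \<in> Obj C \<Longrightarrow> e A \<in> Hom C A (X A)"
    and U: "\<And>A Y g. A \<in> Obj C \<Longrightarrow> Y \<in> \<F> \<Longrightarrow> g \<in> Hom C A Y \<Longrightarrow> \<exists>!h. h \<in> Hom C (X A) Y \<and> h \<cdot>\<^bsub>C\<^esub> e A = g"
    by metis
  define r where "r f = (THE h. h \<in> Hom C (X (Dom C f)) (X (Cod C f)) \<and> h \<cdot>\<^bsub>C\<^esub> e (Dom C f) = e (Cod C f) \<cdot>\<^bsub>C\<^esub> f)" for f
  have ob: "A \<in> Obj C" "B \<in> Obj C" if "f \<in> Hom C A B" for f A B
    using that Dom_in_Obj Cod_in_Obj by (auto simp: Hom_def)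
  have r: "r f \<in> Hom C (X A) (X B) \<and> r f \<cdot>\<^bsub>C\<^esub> e A = e B \<cdot>\<^bsub>C\<^esub> f" if f: "f \<in> Hom C A B" for f A B
  proof -
    have d: "Dom C f = A" "Cod C f = B" using f by (auto simp: Hom_def)
    have "e B \<cdot>\<^bsub>C\<^esub> f \<in> Hom C A (X B)" using Cmp_in_Hom[OF f e] ob[OF f] by blast
    from theI'[OF U[OF ob(1)[OF f] XF[OF ob(2)[OF f]] this]] show ?thesis
      unfolding r_def d .
  qed
  have uniq: "h = h'" if "A \<in> Obj C" "Y \<in> \<F>" "h \<in> Hom C (X A) Y" "h' \<in> Hom C (X A) Y" "h \<cdot>\<^bsub>C\<^esub> e A = h' \<cdot>\<^bsub>C\<^esub> e A" for h h' A Y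
    using U[OF that(1,2) Cmp_in_Hom[OF e[OF that(1)] that(3)]] that by metis
  have FO: "\<F> \<subseteq> Obj C" using tt by (simp add: torsion_theory_def replete_def)
  let ?R = "\<lparr>FObj = X, FArr = r\<rparr>"
  have 1: "r (Id C A) = Id C (X A)" if A: "A \<in> Obj C" for A
  proof (rule uniq[OF A XF[OF A]])
    show "r (Id C A) \<in> Hom C (X A) (X A)" using r[OF Id_in_Hom[OF A]] by blast
    show "Id C (X A) \<in> Hom C (X A) (X A)" using Id_in_Hom XF[OF A] FO by blast
    show "r (Id C A) \<cdot>\<^bsub>C\<^esub> e A = Id C (X A) \<cdot>\<^bsub>C\<^esub> e A"
      using r[OF Id_in_Hom[OF A]] Cmp_Id_right[OF e[OF A]] Cmp_Id_left[OF e[OF A]] by simp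
  qed
  have 2: "r (g \<cdot>\<^bsub>C\<^esub> f) = r g \<cdot>\<^bsub>C\<^esub> r f" if f: "f \<in> Hom C A B" and g: "g \<in> Hom C B D" for A B D f g
  proof (rule uniq[OF ob(1)[OF f] XF[OF ob(2)[OF g]]])
    note gf = Cmp_in_Hom[OF f g]
    show "r (g \<cdot>\<^bsub>C\<^esub> f) \<in> Hom C (X A) (X D)" using r[OF gf] by blast
    show "r g \<cdot>\<^bsub>C\<^esub> r f \<in> Hom C (X A) (X D)" using r[OF f] r[OF g] Cmp_in_Hom by blast
    have eA: "e A \<in> Hom C A (X A)" "e B \<in> Hom C B (X B)" "e D \<in> Hom C D (X D)" using e ob f g by blast+
    show "r (g \<cdot>\<^bsub>C\<^esub> f) \<cdot>\<^bsub>C\<^esub> e A = (r g \<cdot>\<^bsub>C\<^esub> r f) \<cdot>\<^bsub>C\<^esub> e A"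
    proof -
      have rf: "r f \<in> Hom C (X A) (X B)" "r f \<cdot>\<^bsub>C\<^esub> e A = e B \<cdot>\<^bsub>C\<^esub> f"
        and rg: "r g \<in> Hom C (X B) (X D)" "r g \<cdot>\<^bsub>C\<^esub> e B = e D \<cdot>\<^bsub>C\<^esub> g"
        using r[OF f] r[OF g] by auto
      have "(r g \<cdot>\<^bsub>C\<^esub> r f) \<cdot>\<^bsub>C\<^esub> e A = r g \<cdot>\<^bsub>C\<^esub> (e B \<cdot>\<^bsub>C\<^esub> f)"
        using Cmp_assoc[OF eA(1) rf(1) rg(1)] rf(2) by simp
      also have "\<dots> = (e D \<cdot>\<^bsub>C\<^esub> g) \<cdot>\<^bsub>C\<^esub> f"
        using Cmp_assoc[OF f eA(2) rg(1)] rg(2) by simp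
      also have "\<dots> = r (g \<cdot>\<^bsub>C\<^esub> f) \<cdot>\<^bsub>C\<^esub> e A"
        using Cmp_assoc[OF f g eA(3)] r[OF gf] by simp
      finally show ?thesis by simp
    qed
  qed
  have H: "Hom (full_subcategory C \<F>) A B = Hom C A B" if "A \<in> \<F>" "B \<in> \<F>" for A B
    using that by (auto simp: Hom_def full_subcategory_def)
  have "is_functor C (full_subcategory C \<F>) ?R"
    unfolding is_functor_def
  proof (intro conjI ballI allI)
    show "FObj ?R A \<in> Obj (full_subcategory C \<F>)" if "A \<in> Obj C" for A
      using XF[OF that] by (simp add: full_subcategory_def)
    show "FArr ?R f \<in> Hom (full_subcategory C \<F>) (FObj ?R A) (FObj ?R B)"
      if f: "f \<in> Hom C A B" for A B f
      using r[OF f] H[OF XF[OF ob(1)[OF f]] XF[OF ob(2)[OF f]]] by simp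
    show "FArr ?R (Id C A) = Id (full_subcategory C \<F>) (FObj ?R A)" if "A \<in> Obj C" for A
      using 1[OF that] by (simp add: full_subcategory_def)
    show "FArr ?R (g \<cdot>\<^bsub>C\<^esub> f) = FArr ?R g \<cdot>\<^bsub>full_subcategory C \<F>\<^esub> FArr ?R f"
      if "f \<in> Hom C A B" "g \<in> Hom C B D" for A B D f g
      using 2[OF that] by (simp add: full_subcategory_def)
  qed
  then have "reflector C \<F> ?R" unfolding reflector_def
    using e r U by (intro conjI exI[of _ e]) simp_all
  then show ?thesis ..
qed

end

theory Submission
  imports Defs
begin

text \<open>If the reflector \<open>F\<close> is protoadditive and \<open>k: K \<rightarrow> A\<close> is the kernel of a split epimorphism
  with \<open>A\<close> torsion, then \<open>F k\<close> is a monomorphism into the zero object \<open>F A\<close>, so \<open>F K = 0\<close> and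
  \<open>K\<close> is torsion. Conversely, let \<open>k\<close> be the kernel of \<open>f: A \<rightarrow> B\<close>, split by \<open>s\<close>, let \<open>L\<close> be the
  kernel of \<open>F f\<close>, and let \<open>\<phi>: K \<rightarrow> F K \<rightarrow> L\<close> be the comparison. The kernel of the
  split epimorphism \<open>T A \<rightarrow> T B\<close> is torsion by heredity, which makes \<open>T K\<close> the kernel of \<open>\<phi>\<close>.
  Moreover \<open>\<phi>\<close> is a pullback of the comparison \<open>d\<close> from \<open>A\<close> to the pullback \<open>P\<close> of \<open>F f\<close> along
  \<open>B \<rightarrow> F B\<close>, and \<open>d\<close> is a regular epimorphism: the image of \<open>d\<close> maps onto \<open>F A\<close> and contains the
  kernel \<open>T B\<close> of \<open>P \<rightarrow> F A\<close>, as \<open>T A \<rightarrow> T B\<close> is split. Thus \<open>\<phi>\<close> and \<open>K \<rightarrow> F K\<close> are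
  regular epimorphisms with the same kernel, whence \<open>F K \<cong> L\<close>.\<close>

section \<open>Composition, monomorphisms and isomorphisms\<close>

context category
begin

lemma Id_arr [simp]:
  assumes "A \<in> Obj C"
  shows "Id C A \<in> Arr C" "Dom C (Id C A) = A" "Cod C (Id C A) = A"
  using Id_in_Hom[OF assms] by (auto simp: Hom_def)

lemma comp_arr [simp]:
  assumes "f \<in> Arr C" "g \<in> Arr C" "Cod C f = Dom C g"
  shows "g \<cdot> f \<in> Arr C" "Dom C (g \<cdot> f) = Dom C f" "Cod C (g \<cdot> f) = Cod C g"
  using Cmp_in_Hom[of f "Dom C f" "Cod C f" g "Cod C g"] assms by (auto simp: Hom_def)

lemma comp_Id_right [simp]: "f \<in> Arr C \<Longrightarrow> Dom C f = A \<Longrightarrow> f \<cdot> Id C A = f"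
  using Cmp_Id_right[of f A "Cod C f"] by (auto simp: Hom_def)

lemma comp_Id_left [simp]: "f \<in> Arr C \<Longrightarrow> Cod C f = A \<Longrightarrow> Id C A \<cdot> f = f"
  using Cmp_Id_left[of f "Dom C f" A] by (auto simp: Hom_def)

lemma comp_assoc [simp]:
  assumes "f \<in> Arr C" "g \<in> Arr C" "h \<in> Arr C" "Cod C f = Dom C g" "Cod C g = Dom C h"
  shows "(h \<cdot> g) \<cdot> f = h \<cdot> (g \<cdot> f)"
  using Cmp_assoc[of f "Dom C f" "Cod C f" g "Cod C g" h "Cod C h"] assms by (auto simp: Hom_def)

lemma Dom_Cod_Obj [simp]:
  assumes "f \<in> Arr C"
  shows "Dom C f \<in> Obj C" "Cod C f \<in> Obj C"
  using assms Dom_in_Obj Cod_in_Obj by auto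

text \<open>\<open>comp_assoc\<close> nests composites to the right, which hides a factor
  \<open>g \<cdot> f\<close> inside \<open>g \<cdot> (f \<cdot> x)\<close>. This lemma and
  \<open>comp_reassoc1\<close> make an equation for \<open>g \<cdot> f\<close> applicable
  there.\<close>

lemma comp_reassoc:
  assumes "g \<cdot> f = k \<cdot> h" "f \<in> Arr C" "g \<in> Arr C" "h \<in> Arr C" "k \<in> Arr C" "x \<in> Arr C"
    "Cod C f = Dom C g" "Cod C h = Dom C k" "Cod C x = Dom C f" "Cod C x = Dom C h"
  shows "g \<cdot> (f \<cdot> x) = k \<cdot> (h \<cdot> x)"
proof -
  have "(g \<cdot> f) \<cdot> x = (k \<cdot> h) \<cdot> x" using assms(1) by simp
  then show ?thesis using assms(2-) by simp
qed

lemma comp_reassoc1: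
  assumes "g \<cdot> f = k" "f \<in> Arr C" "g \<in> Arr C" "x \<in> Arr C" "Cod C f = Dom C g" "Cod C x = Dom C f"
  shows "g \<cdot> (f \<cdot> x) = k \<cdot> x"
  using assms by (metis comp_assoc)

lemma mono_cancel:
  assumes "is_mono C m" "m \<cdot> f = m \<cdot> g" "f \<in> Arr C" "g \<in> Arr C"
    "Cod C f = Dom C m" "Cod C g = Dom C m" "Dom C f = Dom C g"
  shows "f = g"
  using assms unfolding is_mono_def Hom_def by blast

lemma isoI:
  assumes "f \<in> Arr C" "g \<in> Arr C" "Dom C g = Cod C f" "Cod C g = Dom C f"
    "g \<cdot> f = Id C (Dom C f)" "f \<cdot> g = Id C (Cod C f)"
  shows "is_iso C f"
  using assms unfolding is_iso_def Hom_def by blast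

lemma isoE:
  assumes "is_iso C f"
  obtains g where "f \<in> Arr C" "g \<in> Arr C" "Dom C g = Cod C f" "Cod C g = Dom C f"
    "g \<cdot> f = Id C (Dom C f)" "f \<cdot> g = Id C (Cod C f)"
  using assms unfolding is_iso_def Hom_def by blast

section \<open>Zero arrows\<close>

lemma zero_arrowE:
  assumes "is_zero_arrow C f"
  obtains Z u v where "is_zero_object C Z" "u \<in> Arr C" "v \<in> Arr C" "Dom C u = Dom C f"
    "Cod C u = Z" "Dom C v = Z" "Cod C v = Cod C f" "v \<cdot> u = f"
  using assms unfolding is_zero_arrow_def Hom_def by blast

lemma zero_arrowI:
  assumes "is_zero_object C Z" "u \<in> Arr C" "v \<in> Arr C" "Cod C u = Z" "Dom C v = Z"
  shows "is_zero_arrow C (v \<cdot> u)"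
proof -
  have "u \<in> Hom C (Dom C (v \<cdot> u)) Z" "v \<in> Hom C Z (Cod C (v \<cdot> u))" "v \<cdot> u \<in> Arr C"
    using assms by (simp_all add: Hom_def)
  then show ?thesis using assms(1) unfolding is_zero_arrow_def by blast
qed

lemma zero_arrow_comp_left:
  assumes "is_zero_arrow C f" "g \<in> Arr C" "Cod C f = Dom C g"
  shows "is_zero_arrow C (g \<cdot> f)"
proof -
  obtain Z u v where *: "is_zero_object C Z" "u \<in> Arr C" "v \<in> Arr C" "Dom C u = Dom C f"
    "Cod C u = Z" "Dom C v = Z" "Cod C v = Cod C f" and f: "v \<cdot> u = f"
    by (rule zero_arrowE[OF assms(1)])
  have "is_zero_arrow C ((g \<cdot> v) \<cdot> u)" using * assms(2,3) by (intro zero_arrowI[OF *(1)]) simp_all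
  then show ?thesis unfolding f[symmetric] using * assms(2,3) by simp
qed

lemma zero_arrow_comp_right:
  assumes "is_zero_arrow C f" "g \<in> Arr C" "Cod C g = Dom C f"
  shows "is_zero_arrow C (f \<cdot> g)"
proof -
  obtain Z u v where *: "is_zero_object C Z" "u \<in> Arr C" "v \<in> Arr C" "Dom C u = Dom C f"
    "Cod C u = Z" "Dom C v = Z" "Cod C v = Cod C f" and f: "v \<cdot> u = f"
    by (rule zero_arrowE[OF assms(1)])
  have "is_zero_arrow C (v \<cdot> (u \<cdot> g))" using * assms(2,3) by (intro zero_arrowI[OF *(1)]) simp_all
  then show ?thesis unfolding f[symmetric] using * assms(2,3) by simp
qed

lemma zero_object_hom:
  assumes "is_zero_object C Z" "A \<in> Obj C"
  shows "\<exists>!f. f \<in> Hom C A Z" "\<exists>!f. f \<in> Hom C Z A"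
  using assms unfolding is_zero_object_def is_initial_def is_terminal_def by auto

text \<open>The zero object in \<open>is_zero_arrow\<close> may vary from arrow to arrow. Any two
  zero objects are connected by \<open>i\<close> and \<open>j\<close> with
  \<open>j \<cdot> i\<close> an identity, so every zero arrow also factors through a prescribed
  one.\<close>

lemma zero_arrow_through:
  assumes "is_zero_object C Z" "is_zero_arrow C f"
  obtains u v where "u \<in> Hom C (Dom C f) Z" "v \<in> Hom C Z (Cod C f)" "f = v \<cdot> u"
proof -
  obtain Y u v where *: "is_zero_object C Y" "u \<in> Arr C" "v \<in> Arr C" "Dom C u = Dom C f"
    "Cod C u = Y" "Dom C v = Y" "Cod C v = Cod C f" and f: "v \<cdot> u = f"
    by (rule zero_arrowE[OF assms(2)])
  have Y: "Y \<in> Obj C" using *(1) by (simp add: is_zero_object_def is_initial_def)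
  obtain i j where i: "i \<in> Hom C Y Z" and j: "j \<in> Hom C Z Y"
    using zero_object_hom[OF assms(1) Y] by blast
  have ji: "j \<cdot> i = Id C Y"
    using zero_object_hom[OF *(1) Y] Cmp_in_Hom[OF i j] Id_in_Hom[OF Y] by blast
  have "(v \<cdot> j) \<cdot> (i \<cdot> u) = f"
    using * i j comp_reassoc1[OF ji, of u] f by (simp add: Hom_def)
  moreover have "i \<cdot> u \<in> Hom C (Dom C f) Z" "v \<cdot> j \<in> Hom C Z (Cod C f)"
    using * i j by (simp_all add: Hom_def)
  ultimately show thesis using that by blast
qed

lemma zero_arrow_unique:
  assumes "is_zero_arrow C f" "is_zero_arrow C g" "Dom C f = Dom C g" "Cod C f = Cod C g"
  shows "f = g"
proof -
  obtain Z where Z: "is_zero_object C Z" using assms(1) unfolding is_zero_arrow_def by blast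
  have "Dom C g \<in> Obj C" "Cod C g \<in> Obj C" using assms(2) unfolding is_zero_arrow_def by auto
  from zero_object_hom[OF Z this(1)] zero_object_hom[OF Z this(2)] show ?thesis
    using zero_arrow_through[OF Z assms(1)] zero_arrow_through[OF Z assms(2)] assms(3,4) by metis
qed

section \<open>Kernels\<close>

lemma kernelD:
  assumes "is_kernel C k f"
  shows "k \<in> Arr C" "f \<in> Arr C" "Cod C k = Dom C f" "is_zero_arrow C (f \<cdot> k)"
  using assms unfolding is_kernel_def by blast+

lemma kernel_lift:
  assumes "is_kernel C k f" "g \<in> Arr C" "Cod C g = Dom C f" "is_zero_arrow C (f \<cdot> g)"
  shows "\<exists>h. h \<in> Arr C \<and> Dom C h = Dom C g \<and> Cod C h = Dom C k \<and> k \<cdot> h = g"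
proof -
  have "g \<in> Hom C (Dom C g) (Dom C f)" using assms by (simp add: Hom_def)
  then obtain h where "h \<in> Hom C (Dom C g) (Dom C k)" "k \<cdot> h = g"
    using assms(1,4) unfolding is_kernel_def by blast
  then show ?thesis by (auto simp: Hom_def)
qed

lemma kernel_is_mono:
  assumes "is_kernel C k f"
  shows "is_mono C k"
  unfolding is_mono_def
proof (intro conjI allI ballI impI)
  note k = kernelD[OF assms]
  show "k \<in> Arr C" by fact
  fix X x y assume xy: "x \<in> Hom C X (Dom C k)" "y \<in> Hom C X (Dom C k)" "k \<cdot> x = k \<cdot> y"
  have "is_zero_arrow C ((f \<cdot> k) \<cdot> x)"
    using zero_arrow_comp_right[OF k(4), of x] xy k by (simp add: Hom_def)
  then have "is_zero_arrow C (f \<cdot> (k \<cdot> x))" using xy k by (simp add: Hom_def)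
  moreover have "k \<cdot> x \<in> Hom C X (Dom C f)" using xy k by (simp add: Hom_def)
  ultimately have "\<exists>!h. h \<in> Hom C X (Dom C k) \<and> k \<cdot> h = k \<cdot> x"
    using assms unfolding is_kernel_def by blast
  with xy show "x = y" by metis
qed

text \<open>Uniqueness of factorisations is delegated to \<open>is_mono C k\<close>, so that only
  existence is left to be shown for each \<open>g\<close>.\<close>

lemma kernelI:
  assumes "k \<in> Arr C" "f \<in> Arr C" "Cod C k = Dom C f" "is_zero_arrow C (f \<cdot> k)" "is_mono C k"
    and "\<And>g. g \<in> Arr C \<Longrightarrow> Cod C g = Dom C f \<Longrightarrow> is_zero_arrow C (f \<cdot> g) \<Longrightarrow>
      \<exists>h. h \<in> Arr C \<and> Dom C h = Dom C g \<and> Cod C h = Dom C k \<and> k \<cdot> h = g"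
  shows "is_kernel C k f"
  unfolding is_kernel_def
proof (intro conjI allI ballI impI)
  fix X g assume g: "g \<in> Hom C X (Dom C f)" "is_zero_arrow C (f \<cdot> g)"
  then obtain h where "h \<in> Hom C X (Dom C k)" "k \<cdot> h = g"
    using assms(6)[of g] by (auto simp: Hom_def)
  then show "\<exists>!h. h \<in> Hom C X (Dom C k) \<and> k \<cdot> h = g"
    using assms(5) unfolding is_mono_def by blast
qed (use assms in auto)

section \<open>Pullbacks\<close>

lemma pullbackD:
  assumes "is_pullback C p q f g"
  shows "f \<in> Arr C" "g \<in> Arr C" "p \<in> Arr C" "q \<in> Arr C" "Cod C f = Cod C g" "Dom C p = Dom C q"
    "Cod C p = Dom C f" "Cod C q = Dom C g" "f \<cdot> p = g \<cdot> q"
  using assms unfolding is_pullback_def by blast+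

lemma pullback_lift:
  assumes "is_pullback C p q f g" "a \<in> Arr C" "b \<in> Arr C" "Cod C a = Dom C f" "Cod C b = Dom C g"
    "Dom C a = Dom C b" "f \<cdot> a = g \<cdot> b"
  shows "\<exists>h. h \<in> Arr C \<and> Dom C h = Dom C a \<and> Cod C h = Dom C p \<and> p \<cdot> h = a \<and> q \<cdot> h = b"
proof -
  have "a \<in> Hom C (Dom C a) (Dom C f)" "b \<in> Hom C (Dom C a) (Dom C g)"
    using assms by (simp_all add: Hom_def)
  then obtain h where "h \<in> Hom C (Dom C a) (Dom C p)" "p \<cdot> h = a" "q \<cdot> h = b"
    using assms(1,7) unfolding is_pullback_def by blast
  then show ?thesis by (auto simp: Hom_def)
qed

lemma pullback_unique:
  assumes "is_pullback C p q f g" "h \<in> Arr C" "h' \<in> Arr C" "Cod C h = Dom C p" "Cod C h' = Dom C p"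
    "Dom C h = Dom C h'" "p \<cdot> h = p \<cdot> h'" "q \<cdot> h = q \<cdot> h'"
  shows "h = h'"
proof -
  note P = pullbackD[OF assms(1)]
  have "p \<cdot> h \<in> Hom C (Dom C h) (Dom C f)" "q \<cdot> h \<in> Hom C (Dom C h) (Dom C g)"
    using assms P by (auto simp: Hom_def)
  moreover have "f \<cdot> (p \<cdot> h) = g \<cdot> (q \<cdot> h)"
    using assms P by (intro comp_reassoc) auto
  ultimately have "\<exists>!x. x \<in> Hom C (Dom C h) (Dom C p) \<and> p \<cdot> x = p \<cdot> h \<and> q \<cdot> x = q \<cdot> h"
    using assms(1) unfolding is_pullback_def by blast
  moreover have "h \<in> Hom C (Dom C h) (Dom C p)" "h' \<in> Hom C (Dom C h) (Dom C p)"
    using assms by (simp_all add: Hom_def)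
  ultimately show ?thesis using assms(7,8) by metis
qed

lemma pullbackI:
  assumes "f \<in> Arr C" "g \<in> Arr C" "p \<in> Arr C" "q \<in> Arr C" "Cod C f = Cod C g" "Dom C p = Dom C q"
    "Cod C p = Dom C f" "Cod C q = Dom C g" "f \<cdot> p = g \<cdot> q"
    and "\<And>a b. a \<in> Arr C \<Longrightarrow> b \<in> Arr C \<Longrightarrow> Cod C a = Dom C f \<Longrightarrow> Cod C b = Dom C g \<Longrightarrow>
      Dom C a = Dom C b \<Longrightarrow> f \<cdot> a = g \<cdot> b \<Longrightarrow>
      \<exists>!h. h \<in> Hom C (Dom C a) (Dom C p) \<and> p \<cdot> h = a \<and> q \<cdot> h = b"
  shows "is_pullback C p q f g"
  unfolding is_pullback_def
proof (intro conjI allI ballI impI)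
  fix X a b assume "a \<in> Hom C X (Dom C f)" "b \<in> Hom C X (Dom C g)" "f \<cdot> a = g \<cdot> b"
  then show "\<exists>!h. h \<in> Hom C X (Dom C p) \<and> p \<cdot> h = a \<and> q \<cdot> h = b"
    using assms(10)[of a b] by (simp add: Hom_def)
qed (use assms in auto)

lemma pullback_swap:
  assumes pb: "is_pullback C p q f g"
  shows "is_pullback C q p g f"
proof (rule pullbackI)
  note P = pullbackD[OF pb]
  show "g \<in> Arr C" "f \<in> Arr C" "q \<in> Arr C" "p \<in> Arr C" by (rule P)+
  show "Cod C g = Cod C f" "Dom C q = Dom C p" "Cod C q = Dom C g" "Cod C p = Dom C f" "g \<cdot> q = f \<cdot> p"
    by (simp_all only: P)
  fix a b assume "a \<in> Arr C" "b \<in> Arr C" "Cod C a = Dom C g" "Cod C b = Dom C f"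
    "Dom C a = Dom C b" "g \<cdot> a = f \<cdot> b"
  then have "a \<in> Hom C (Dom C b) (Dom C g)" "b \<in> Hom C (Dom C b) (Dom C f)" "f \<cdot> b = g \<cdot> a"
    by (simp_all add: Hom_def)
  then have "\<exists>!h. h \<in> Hom C (Dom C b) (Dom C p) \<and> p \<cdot> h = b \<and> q \<cdot> h = a"
    using pb unfolding is_pullback_def by blast
  then show "\<exists>!h. h \<in> Hom C (Dom C a) (Dom C q) \<and> q \<cdot> h = a \<and> p \<cdot> h = b"
    unfolding \<open>Dom C a = Dom C b\<close> P(6) by (simp only: conj_commute[of "q \<cdot> _ = a"])
qed

text \<open>Parallel sides of a pullback square have the same kernel object: \<open>c\<close> is the
  arrow into the pullback with components \<open>k\<close> and zero.\<close>

lemma kernel_of_pullback: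
  assumes pb: "is_pullback C p q f g" and k: "is_kernel C k f"
    and c: "c \<in> Arr C" "Cod C c = Dom C p" "p \<cdot> c = k" "is_zero_arrow C (q \<cdot> c)"
  shows "is_kernel C c q"
proof -
  note P = pullbackD[OF pb] and K = kernelD[OF k]
  have Dk: "Dom C k = Dom C c" using c P by auto
  have mono: "is_mono C c"
    unfolding is_mono_def
  proof (intro conjI allI ballI impI)
    fix X x y assume xy: "x \<in> Hom C X (Dom C c)" "y \<in> Hom C X (Dom C c)" "c \<cdot> x = c \<cdot> y"
    have "k \<cdot> x = k \<cdot> y"
      using comp_reassoc1[OF c(3), of x] comp_reassoc1[OF c(3), of y] xy c P by (simp add: Hom_def)
    then show "x = y" using mono_cancel[OF kernel_is_mono[OF k], of x y] xy Dk by (simp add: Hom_def)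
  qed (rule c)
  show ?thesis
  proof (rule kernelI)
    fix x assume x: "x \<in> Arr C" "Cod C x = Dom C q" "is_zero_arrow C (q \<cdot> x)"
    have "f \<cdot> (p \<cdot> x) = g \<cdot> (q \<cdot> x)" using x P by (intro comp_reassoc) auto
    then have "is_zero_arrow C (f \<cdot> (p \<cdot> x))" using zero_arrow_comp_left[OF x(3), of g] P x by auto
    then obtain y where y: "y \<in> Arr C" "Dom C y = Dom C x" "Cod C y = Dom C k" "k \<cdot> y = p \<cdot> x"
      using kernel_lift[OF k, of "p \<cdot> x"] P x by auto
    have "q \<cdot> (c \<cdot> y) = (q \<cdot> c) \<cdot> y" using y c P Dk by simp
    then have z: "is_zero_arrow C (q \<cdot> (c \<cdot> y))"
      using zero_arrow_comp_right[OF c(4), of y] y Dk P c by simp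
    \<comment> \<open>The \<open>p\<close> components agree by the choice of \<open>y\<close>; the
      \<open>q\<close> components are both zero.\<close>
    have "c \<cdot> y = x"
    proof (rule pullback_unique[OF pb])
      show "p \<cdot> (c \<cdot> y) = p \<cdot> x" using comp_reassoc1[OF c(3), of y] y Dk c P by simp
      show "q \<cdot> (c \<cdot> y) = q \<cdot> x" using zero_arrow_unique[OF z x(3)] x y Dk c P by simp
    qed (use x y c P Dk in auto)
    then show "\<exists>h. h \<in> Arr C \<and> Dom C h = Dom C x \<and> Cod C h = Dom C c \<and> c \<cdot> h = x"
      using y Dk by auto
  qed (use c P mono in auto)
qed

text \<open>An arrow killed by \<open>p \<cdot> m\<close> is lifted through the kernel of
  \<open>p\<close> after composing with \<open>m\<close>, and \<open>m\<close> is then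
  cancelled.\<close>

lemma kernel_comp_mono:
  assumes m: "is_mono C m" and c: "c \<in> Arr C" "Cod C c = Dom C m"
    and k: "is_kernel C (m \<cdot> c) p"
  shows "is_kernel C c (p \<cdot> m)"
proof -
  note K = kernelD[OF k]
  have M: "m \<in> Arr C" using m by (simp add: is_mono_def)
  have Mc: "Cod C m = Dom C p" using K M c by simp
  have mono: "is_mono C c"
    unfolding is_mono_def
  proof (intro conjI allI ballI impI)
    fix X x y assume xy: "x \<in> Hom C X (Dom C c)" "y \<in> Hom C X (Dom C c)" "c \<cdot> x = c \<cdot> y"
    then have "(m \<cdot> c) \<cdot> x = (m \<cdot> c) \<cdot> y" using c M by (simp add: Hom_def)
    then show "x = y" using mono_cancel[OF kernel_is_mono[OF k], of x y] xy c M by (simp add: Hom_def)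
  qed (rule c)
  show ?thesis
  proof (rule kernelI)
    show "is_zero_arrow C ((p \<cdot> m) \<cdot> c)" using K M c Mc by simp
    fix g assume g: "g \<in> Arr C" "Cod C g = Dom C (p \<cdot> m)" "is_zero_arrow C ((p \<cdot> m) \<cdot> g)"
    obtain h where h: "h \<in> Arr C" "Dom C h = Dom C g" "Cod C h = Dom C c" "(m \<cdot> c) \<cdot> h = m \<cdot> g"
      using kernel_lift[OF k, of "m \<cdot> g"] g K M Mc c by auto
    then have "c \<cdot> h = g" using mono_cancel[OF m, of "c \<cdot> h" g] g M Mc c K by simp
    then show "\<exists>h. h \<in> Arr C \<and> Dom C h = Dom C g \<and> Cod C h = Dom C c \<and> c \<cdot> h = g"
      using h by blast
  qed (use K M c Mc mono in auto)
qed

section \<open>Coequalisers and regular epimorphisms\<close>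

lemma coequalizerD:
  assumes "is_coequalizer C e u v"
  shows "e \<in> Arr C" "u \<in> Arr C" "v \<in> Arr C" "Dom C v = Dom C u" "Cod C v = Cod C u"
    "Dom C e = Cod C u" "e \<cdot> u = e \<cdot> v"
  using assms unfolding is_coequalizer_def Hom_def by blast+

lemma coequalizer_ex1:
  assumes "is_coequalizer C e u v" "g \<in> Hom C (Dom C e) X" "g \<cdot> u = g \<cdot> v"
  shows "\<exists>!h. h \<in> Hom C (Cod C e) X \<and> h \<cdot> e = g"
proof -
  have "\<forall>X. \<forall>g \<in> Hom C (Dom C e) X. g \<cdot> u = g \<cdot> v \<longrightarrow>
      (\<exists>!h. h \<in> Hom C (Cod C e) X \<and> h \<cdot> e = g)"
    using assms(1) unfolding is_coequalizer_def by (elim conjE)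
  from bspec[OF spec[OF this] assms(2)] assms(3) show ?thesis by (rule mp)
qed

lemma coequalizer_factor:
  assumes "is_coequalizer C e u v" "g \<in> Arr C" "Dom C g = Dom C e" "g \<cdot> u = g \<cdot> v"
  shows "\<exists>h. h \<in> Arr C \<and> Dom C h = Cod C e \<and> Cod C h = Cod C g \<and> h \<cdot> e = g"
proof -
  have "g \<in> Hom C (Dom C e) (Cod C g)" using assms by (simp add: Hom_def)
  from coequalizer_ex1[OF assms(1) this assms(4)]
  obtain h where "h \<in> Hom C (Cod C e) (Cod C g)" "h \<cdot> e = g" by auto
  then show ?thesis by (auto simp: Hom_def)
qed

lemma regular_epi_cancel:
  assumes "is_regular_epi C e" "g \<cdot> e = h \<cdot> e" "g \<in> Arr C" "h \<in> Arr C"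
    "Dom C g = Cod C e" "Dom C h = Cod C e" "Cod C g = Cod C h"
  shows "g = h"
proof -
  obtain u v where e: "is_coequalizer C e u v" using assms(1) by (auto simp: is_regular_epi_def)
  note E = coequalizerD[OF e]
  have "h \<cdot> e \<in> Hom C (Dom C e) (Cod C h)" using assms E by (simp add: Hom_def)
  moreover have "(h \<cdot> e) \<cdot> u = (h \<cdot> e) \<cdot> v" using assms E by simp
  ultimately have "\<exists>!x. x \<in> Hom C (Cod C e) (Cod C h) \<and> x \<cdot> e = h \<cdot> e"
    by (rule coequalizer_ex1[OF e])
  moreover have "g \<in> Hom C (Cod C e) (Cod C h)" "h \<in> Hom C (Cod C e) (Cod C h)"
    using assms by (simp_all add: Hom_def)
  ultimately show ?thesis using assms(2) by metis
qed

lemma regular_epi_arr: "is_regular_epi C e \<Longrightarrow> e \<in> Arr C"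
  unfolding is_regular_epi_def is_coequalizer_def by blast

text \<open>Regular epimorphisms are extremal. Cancelling \<open>m\<close> shows that
  \<open>x\<close> coequalises the pair of which \<open>m \<cdot> x\<close> is the coequaliser, so
  \<open>x\<close> factors through \<open>m \<cdot> x\<close>; the factor \<open>h\<close> is the
  inverse of \<open>m\<close>.\<close>

lemma iso_if_regular_epi_factors:
  assumes m: "is_mono C m" and e: "is_regular_epi C (m \<cdot> x)"
    and x: "x \<in> Arr C" "Cod C x = Dom C m"
  shows "is_iso C m"
proof -
  have M: "m \<in> Arr C" using m by (simp add: is_mono_def)
  obtain u v where co: "is_coequalizer C (m \<cdot> x) u v" using e by (auto simp: is_regular_epi_def)
  note E = coequalizerD[OF co]
  have "x \<cdot> u = x \<cdot> v" using mono_cancel[OF m, of "x \<cdot> u" "x \<cdot> v"] E x M by simp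
  then obtain h where h: "h \<in> Arr C" "Dom C h = Cod C m" "Cod C h = Dom C m" "h \<cdot> (m \<cdot> x) = x"
    using coequalizer_factor[OF co, of x] x M by auto
  have mh: "m \<cdot> h = Id C (Cod C m)"
    using regular_epi_cancel[OF e, of "m \<cdot> h" "Id C (Cod C m)"] h x M by simp
  then have "m \<cdot> (h \<cdot> m) = m \<cdot> Id C (Dom C m)"
    using comp_reassoc1[OF mh, of m] h M by simp
  then have "h \<cdot> m = Id C (Dom C m)" using mono_cancel[OF m, of "h \<cdot> m" "Id C (Dom C m)"] h M by simp
  then show ?thesis using isoI[of m h] h M mh by simp
qed

lemma regular_epi_comp_iso:
  assumes e: "is_regular_epi C e" and m: "is_iso C m" and "Cod C e = Dom C m"
  shows "is_regular_epi C (m \<cdot> e)"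
proof -
  obtain u v where co: "is_coequalizer C e u v" using e by (auto simp: is_regular_epi_def)
  note E = coequalizerD[OF co]
  obtain n where n: "m \<in> Arr C" "n \<in> Arr C" "Dom C n = Cod C m" "Cod C n = Dom C m"
    "n \<cdot> m = Id C (Dom C m)" "m \<cdot> n = Id C (Cod C m)"
    by (rule isoE[OF m])
  have "is_coequalizer C (m \<cdot> e) u v"
    unfolding is_coequalizer_def
  proof (intro conjI allI ballI impI)
    fix X g assume g: "g \<in> Hom C (Dom C (m \<cdot> e)) X" "g \<cdot> u = g \<cdot> v"
    then obtain h where h: "h \<in> Arr C" "Dom C h = Cod C e" "Cod C h = X" "h \<cdot> e = g"
      using coequalizer_factor[OF co, of g] assms(3) E n by (auto simp: Hom_def)
    show "\<exists>!h. h \<in> Hom C (Cod C (m \<cdot> e)) X \<and> h \<cdot> (m \<cdot> e) = g"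
    proof (rule ex1I[of _ "h \<cdot> n"])
      show "h \<cdot> n \<in> Hom C (Cod C (m \<cdot> e)) X \<and> (h \<cdot> n) \<cdot> (m \<cdot> e) = g"
        using h n E assms(3) comp_reassoc1[OF n(5), of e] by (simp add: Hom_def)
      fix h' assume h': "h' \<in> Hom C (Cod C (m \<cdot> e)) X \<and> h' \<cdot> (m \<cdot> e) = g"
      have "h' \<cdot> m = h"
        using regular_epi_cancel[OF e, of "h' \<cdot> m" h] h h' n E assms(3) by (simp add: Hom_def)
      then have "(h' \<cdot> m) \<cdot> n = h \<cdot> n" by simp
      then show "h' = h \<cdot> n" using h' n E assms(3) by (simp add: Hom_def)
    qed
  qed (use E n assms(3) in \<open>auto simp: Hom_def\<close>)
  then show ?thesis by (auto simp: is_regular_epi_def)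
qed

section \<open>Full subcategories\<close>

lemma category_full_subcategory: "S \<subseteq> Obj C \<Longrightarrow> category (full_subcategory C S)"
  by unfold_locales (auto simp: full_subcategory_def Hom_def)

text \<open>Each side refers to the zero objects of its own category. Since \<open>Z\<close> lies in
  \<open>S\<close> and fullness keeps its hom-sets, \<open>Z\<close> is a zero object of both, and a
  zero arrow of either category factors through it.\<close>

lemma zero_arrow_full_subcategory:
  assumes S: "S \<subseteq> Obj C" and Z: "Z \<in> S" "is_zero_object C Z"
    and f: "f \<in> Arr C" "Dom C f \<in> S" "Cod C f \<in> S"
  shows "is_zero_arrow (full_subcategory C S) f \<longleftrightarrow> is_zero_arrow C f"
proof -
  let ?D = "full_subcategory C S"
  interpret D: category ?D by (rule category_full_subcategory[OF S])
  have H: "Hom ?D A B = Hom C A B" if "A \<in> S" "B \<in> S" for A B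
    using that by (auto simp: Hom_def full_subcategory_def)
  have sel: "Obj ?D = S" "Dom ?D = Dom C" "Cod ?D = Cod C" "Cmp ?D = Cmp C"
    by (simp_all add: full_subcategory_def)
  have ZD: "is_zero_object ?D Z"
    using Z(1) subsetD[OF S, THEN zero_object_hom(1)[OF Z(2)]]
      subsetD[OF S, THEN zero_object_hom(2)[OF Z(2)]]
    by (simp add: is_zero_object_def is_initial_def is_terminal_def sel H)
  have "is_zero_arrow C f" if zf: "is_zero_arrow ?D f"
  proof -
    obtain u v where "u \<in> Hom ?D (Dom ?D f) Z" "v \<in> Hom ?D Z (Cod ?D f)" "f = v \<cdot>\<^bsub>?D\<^esub> u"
      by (rule D.zero_arrow_through[OF ZD zf])
    then show ?thesis using f Z unfolding is_zero_arrow_def by (auto simp: sel H)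
  qed
  moreover have "is_zero_arrow ?D f" if zf: "is_zero_arrow C f"
  proof -
    obtain u v where "u \<in> Hom C (Dom C f) Z" "v \<in> Hom C Z (Cod C f)" "f = v \<cdot> u"
      by (rule zero_arrow_through[OF Z(2) zf])
    then have "u \<in> Hom ?D (Dom C f) Z" "v \<in> Hom ?D Z (Cod C f)" "f = v \<cdot>\<^bsub>?D\<^esub> u"
      using f Z(1) by (simp_all only: H sel)
    then show ?thesis using D.zero_arrowI[OF ZD, of u v] by (simp add: Hom_def)
  qed
  ultimately show ?thesis by blast
qed

text \<open>Factorisations through \<open>k\<close> stay inside the full subcategory, so a kernel
  found in the ambient category can be carried over to it.\<close>

lemma kernel_full_subcategory:
  assumes S: "S \<subseteq> Obj C" and Z: "Z \<in> S" "is_zero_object C Z"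
    and k: "is_kernel C k f" and D: "Dom C k \<in> S" "Dom C f \<in> S" "Cod C f \<in> S"
  shows "is_kernel (full_subcategory C S) k f"
proof -
  let ?D = "full_subcategory C S"
  note K = kernelD[OF k]
  interpret D: category ?D by (rule category_full_subcategory[OF S])
  have sel: "Obj ?D = S" "Dom ?D = Dom C" "Cod ?D = Cod C" "Cmp ?D = Cmp C"
    "Arr ?D = {f \<in> Arr C. Dom C f \<in> S \<and> Cod C f \<in> S}"
    by (simp_all add: full_subcategory_def)
  show ?thesis
  proof (rule D.kernelI)
    show "is_zero_arrow ?D (f \<cdot>\<^bsub>?D\<^esub> k)"
      using zero_arrow_full_subcategory[OF S Z, of "f \<cdot> k"] K D by (simp add: sel)
    show "is_mono ?D k"
      using kernel_is_mono[OF k] K D by (auto simp: is_mono_def Hom_def sel)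
    fix g assume g: "g \<in> Arr ?D" "Cod ?D g = Dom ?D f" "is_zero_arrow ?D (f \<cdot>\<^bsub>?D\<^esub> g)"
    then have "is_zero_arrow C (f \<cdot> g)"
      using zero_arrow_full_subcategory[OF S Z, of "f \<cdot> g"] K D by (simp add: sel)
    then obtain h where "h \<in> Arr C" "Dom C h = Dom C g" "Cod C h = Dom C k" "k \<cdot> h = g"
      using kernel_lift[OF k, of g] g by (auto simp: sel)
    then show "\<exists>h. h \<in> Arr ?D \<and> Dom ?D h = Dom ?D g \<and> Cod ?D h = Dom ?D k \<and> k \<cdot>\<^bsub>?D\<^esub> h = g"
      using g D by (auto simp: sel)
  qed (use K D in \<open>auto simp: sel\<close>)
qed

end

section \<open>Pullbacks from finite limits\<close>

text \<open>The shape \<open>0 -> 2 <- 1\<close>: numbers up to 2 are the objects and their own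
  identities, 3 and 4 are the two arrows into 2. In a composite \<open>Cmp j i\<close>, either
  \<open>i\<close> is an identity and the result is \<open>j\<close>, or \<open>i\<close> is 3 or 4,
  \<open>j\<close> is the identity of 2 and the result is \<open>i\<close>.\<close>

definition cospan :: "(nat, nat) precategory" where
  "cospan = \<lparr>Obj = {0, 1, 2}, Arr = {0, 1, 2, 3, 4},
     Dom = (\<lambda>i. if i = 3 then 0 else if i = 4 then 1 else i),
     Cod = (\<lambda>i. if i = 3 \<or> i = 4 then 2 else i),
     Id = (\<lambda>i. i), Cmp = (\<lambda>j i. if i \<le> 2 then j else i)\<rparr>"

lemma category_cospan: "category cospan"
  by unfold_locales (auto simp: cospan_def Hom_def split: if_splits)

lemma (in category) pullback_exists:
  assumes fc: "finitely_complete C" and f: "f \<in> Arr C" and g: "g \<in> Arr C"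
    and fg: "Cod C f = Cod C g"
  shows "\<exists>p q. is_pullback C p q f g"
proof -
  define D where "D = \<lparr>FObj = (\<lambda>i::nat. if i = 0 then Dom C f else if i = 1 then Dom C g else Cod C f),
    FArr = (\<lambda>i::nat. if i = 3 then f else if i = 4 then g else if i = 0 then Id C (Dom C f)
      else if i = 1 then Id C (Dom C g) else Id C (Cod C f))\<rparr>"
  have "is_functor cospan C D"
    unfolding is_functor_def
    using f g fg by (auto simp: cospan_def D_def Hom_def split: if_splits)
  moreover have "finite (Obj cospan)" "finite (Arr cospan)" by (simp_all add: cospan_def)
  ultimately obtain L \<pi> where L: "is_limit cospan C D L \<pi>"
    using fc category_cospan unfolding finitely_complete_def by blast
  have hom: "Hom cospan i j = (if i = j \<and> i \<le> 2 then {i} else if i = 0 \<and> j = 2 then {3}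
      else if i = 1 \<and> j = 2 then {4} else {})" for i j
    by (auto simp: cospan_def Hom_def split: if_splits)
  \<comment> \<open>The leg at 2 is forced by the others, so cones over \<open>D\<close> amount to
    commutative squares on \<open>f\<close> and \<open>g\<close>.\<close>
  have cone: "is_cone cospan C D M \<mu> \<longleftrightarrow> M \<in> Obj C \<and> \<mu> 0 \<in> Hom C M (Dom C f) \<and>
      \<mu> 1 \<in> Hom C M (Dom C g) \<and> f \<cdot> \<mu> 0 = \<mu> 2 \<and> g \<cdot> \<mu> 1 = \<mu> 2" for M \<mu>
  proof
    assume c: "is_cone cospan C D M \<mu>"
    then have "FArr D 3 \<cdot> \<mu> 0 = \<mu> 2" "FArr D 4 \<cdot> \<mu> 1 = \<mu> 2"
      using hom[of 0 2] hom[of 1 2] unfolding is_cone_def by auto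
    with c show "M \<in> Obj C \<and> \<mu> 0 \<in> Hom C M (Dom C f) \<and>
      \<mu> 1 \<in> Hom C M (Dom C g) \<and> f \<cdot> \<mu> 0 = \<mu> 2 \<and> g \<cdot> \<mu> 1 = \<mu> 2"
      unfolding is_cone_def by (auto simp: cospan_def D_def)
  next
    assume c: "M \<in> Obj C \<and> \<mu> 0 \<in> Hom C M (Dom C f) \<and>
      \<mu> 1 \<in> Hom C M (Dom C g) \<and> f \<cdot> \<mu> 0 = \<mu> 2 \<and> g \<cdot> \<mu> 1 = \<mu> 2"
    have "f \<cdot> \<mu> 0 \<in> Hom C M (Cod C f)"
      using c f Cmp_in_Hom[of "\<mu> 0" M "Dom C f" f "Cod C f"] by (simp add: Hom_def)
    with c have "\<mu> 2 \<in> Hom C M (Cod C f)" by simp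
    with c show "is_cone cospan C D M \<mu>"
      unfolding is_cone_def hom
      using f g fg by (auto simp: cospan_def D_def Hom_def numeral_2_eq_2 le_Suc_eq split: if_splits)
  qed
  have "is_cone cospan C D L \<pi>" using L by (simp add: is_limit_def)
  then have l: "L \<in> Obj C" "\<pi> 0 \<in> Hom C L (Dom C f)" "\<pi> 1 \<in> Hom C L (Dom C g)"
      "f \<cdot> \<pi> 0 = \<pi> 2" "g \<cdot> \<pi> 1 = \<pi> 2" by (simp_all add: cone)
  have "is_pullback C (\<pi> 0) (\<pi> 1) f g"
  proof (rule pullbackI)
    fix a b assume ab: "a \<in> Arr C" "b \<in> Arr C" "Cod C a = Dom C f" "Cod C b = Dom C g"
      "Dom C a = Dom C b" "f \<cdot> a = g \<cdot> b"
    define \<mu> where "\<mu> i = (if i = 0 then a else if i = 1 then b else f \<cdot> a)" for i :: nat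
    have "is_cone cospan C D (Dom C a) \<mu>" using ab by (simp add: cone \<mu>_def Hom_def)
    then have "\<exists>!h. h \<in> Hom C (Dom C a) L \<and> (\<forall>j \<in> Obj cospan. \<pi> j \<cdot> h = \<mu> j)"
      using L by (simp add: is_limit_def)
    moreover have "(\<forall>j \<in> Obj cospan. \<pi> j \<cdot> h = \<mu> j) \<longleftrightarrow> \<pi> 0 \<cdot> h = a \<and> \<pi> 1 \<cdot> h = b"
      if "h \<in> Hom C (Dom C a) L" for h
      using that l f g by (auto simp: cospan_def \<mu>_def Hom_def simp flip: l(4))
    ultimately show "\<exists>!h. h \<in> Hom C (Dom C a) (Dom C (\<pi> 0)) \<and> \<pi> 0 \<cdot> h = a \<and> \<pi> 1 \<cdot> h = b"
      using l(2) unfolding Hom_def by (smt (verit) mem_Collect_eq)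
  qed (use l f g fg in \<open>auto simp: Hom_def\<close>)
  then show ?thesis by blast
qed

section \<open>Zero arrows in pointed categories and the split short five lemma\<close>

lemma (in pointed_category) zero_arrow_exists:
  assumes "A \<in> Obj C" "B \<in> Obj C"
  shows "\<exists>z. z \<in> Arr C \<and> Dom C z = A \<and> Cod C z = B \<and> is_zero_arrow C z"
proof -
  obtain Z where Z: "is_zero_object C Z" using zero_object_exists by blast
  obtain u v where uv: "u \<in> Hom C A Z" "v \<in> Hom C Z B"
    using zero_object_hom[OF Z assms(1)] zero_object_hom[OF Z assms(2)] by blast
  then have vu: "v \<cdot> u \<in> Arr C" "Dom C (v \<cdot> u) = A" "Cod C (v \<cdot> u) = B" by (simp_all add: Hom_def)
  then have "is_zero_arrow C (v \<cdot> u)" using Z uv unfolding is_zero_arrow_def by blast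
  then show ?thesis using vu by blast
qed

text \<open>\<open>m\<close> also sends the zero arrow \<open>z\<close> parallel to \<open>f\<close>
  to a zero arrow, so \<open>m \<cdot> f = m \<cdot> z\<close>.\<close>

lemma (in pointed_category) mono_zero_cancel:
  assumes "is_mono C m" "is_zero_arrow C (m \<cdot> f)" "f \<in> Arr C" "Cod C f = Dom C m"
  shows "is_zero_arrow C f"
proof -
  have M: "m \<in> Arr C" using assms(1) by (simp add: is_mono_def)
  obtain z where z: "z \<in> Arr C" "Dom C z = Dom C f" "Cod C z = Dom C m" "is_zero_arrow C z"
    using zero_arrow_exists[of "Dom C f" "Dom C m"] assms M by auto
  have "m \<cdot> f = m \<cdot> z"
    using zero_arrow_unique[OF assms(2) zero_arrow_comp_left[OF z(4)]] z M assms by simp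
  then show ?thesis using mono_cancel[OF assms(1), of f z] z assms by simp
qed

text \<open>This is the split short five lemma with identities on the kernel and on the codomain of
  \<open>f\<close>; the section \<open>s\<close> of \<open>f \<cdot> w\<close> provides the section
  \<open>w \<cdot> s\<close> of \<open>f\<close>.\<close>

lemma (in protomodular_category) iso_if_same_kernel:
  assumes w: "w \<in> Arr C" "Cod C w = Dom C f" and s: "is_section_of C s (f \<cdot> w)"
    and k: "is_kernel C k (f \<cdot> w)" and wk: "is_kernel C (w \<cdot> k) f"
  shows "is_iso C w"
proof (rule split_short_five)
  note K = kernelD[OF k] and F = kernelD[OF wk]
  have S: "s \<in> Arr C" "Dom C s = Cod C f" "Cod C s = Dom C w" "f \<cdot> (w \<cdot> s) = Id C (Cod C f)"
    using s w F unfolding is_section_of_def by (auto simp: Hom_def)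
  have Kd: "Cod C k = Dom C w" using K w F by simp
  have I: "is_iso C (Id C A)" if "A \<in> Obj C" for A
    using isoI[of "Id C A" "Id C A"] that by simp
  show "is_iso C (Id C (Dom C k))" "is_iso C (Id C (Cod C f))" using I K F by auto
  show "split_short_exact_morphism C (Id C (Dom C k), w, Id C (Cod C f)) (k, f \<cdot> w, s) (w \<cdot> k, f, w \<cdot> s)"
    unfolding split_short_exact_morphism_def split_short_exact_def
    using k wk s S K F w Kd by (simp add: Hom_def is_section_of_def)
qed

section \<open>Kernels and regular epimorphisms in homological categories\<close>

context homological_category
begin

lemma pullbacks:
  assumes "f \<in> Arr C" "g \<in> Arr C" "Cod C f = Cod C g"
  obtains p q where "is_pullback C p q f g"
  using pullback_exists[OF finitely_complete assms] by blast

text \<open>The kernel is the pullback along \<open>f\<close> of the arrow \<open>z\<close> from a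
  zero object.\<close>

lemma kernel_exists:
  assumes f: "f \<in> Arr C"
  obtains k where "is_kernel C k f"
proof -
  obtain Z where Z: "is_zero_object C Z" using zero_object_exists by blast
  then have ZO: "Z \<in> Obj C" by (simp add: is_zero_object_def is_initial_def)
  obtain z where z: "z \<in> Hom C Z (Cod C f)" using zero_object_hom[OF Z, of "Cod C f"] f by auto
  obtain p q where pb: "is_pullback C p q f z" using pullbacks[of f z] f z by (auto simp: Hom_def)
  note P = pullbackD[OF pb]
  have ter: "x = y" if "x \<in> Arr C" "y \<in> Arr C" "Dom C x = Dom C y" "Cod C x = Z" "Cod C y = Z" for x y
    using zero_object_hom(1)[OF Z, of "Dom C y"] that by (auto simp: Hom_def)
  have zP: "Dom C z = Z" "Cod C z = Cod C f" using z by (auto simp: Hom_def)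
  have "is_kernel C p f"
  proof (rule kernelI)
    show "is_zero_arrow C (f \<cdot> p)"
      using P z Z unfolding is_zero_arrow_def by (auto simp: Hom_def)
    show "is_mono C p"
      unfolding is_mono_def
    proof (intro conjI allI ballI impI)
      fix X x y assume "x \<in> Hom C X (Dom C p)" "y \<in> Hom C X (Dom C p)" "p \<cdot> x = p \<cdot> y"
      then show "x = y"
        using pullback_unique[OF pb, of x y] ter[of "q \<cdot> x" "q \<cdot> y"] P zP by (simp add: Hom_def)
    qed (rule P)
    fix g assume g: "g \<in> Arr C" "Cod C g = Dom C f" "is_zero_arrow C (f \<cdot> g)"
    have fg: "Dom C (f \<cdot> g) = Dom C g" "Cod C (f \<cdot> g) = Cod C f" using f g by simp_all
    obtain u v where uv: "u \<in> Hom C (Dom C g) Z" "v \<in> Hom C Z (Cod C f)" "f \<cdot> g = v \<cdot> u"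
      by (rule zero_arrow_through[OF Z g(3), unfolded fg])
    have "v = z" using zero_object_hom(2)[OF Z, of "Cod C f"] uv z f by auto
    then show "\<exists>h. h \<in> Arr C \<and> Dom C h = Dom C g \<and> Cod C h = Dom C p \<and> p \<cdot> h = g"
      using pullback_lift[OF pb, of g u] uv g zP by (auto simp: Hom_def)
  qed (use P in auto)
  then show thesis using that by blast
qed

text \<open>The stability axiom concerns a whole factorisation; here its mono part is taken to be
  the identity of \<open>Cod C e\<close>, whose pullback along \<open>g\<close> is again an
  identity.\<close>

lemma regular_epi_pullback:
  assumes e: "is_regular_epi C e" and pb: "is_pullback C g' e' e g"
  shows "is_regular_epi C e'"
proof -
  note P = pullbackD[OF pb]
  have O: "Dom C g \<in> Obj C" "Cod C e \<in> Obj C" using P by auto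
  have "is_mono C (Id C (Cod C e))"
    unfolding is_mono_def
  proof (intro conjI allI ballI impI)
    fix X x y assume "x \<in> Hom C X (Dom C (Id C (Cod C e)))" "y \<in> Hom C X (Dom C (Id C (Cod C e)))"
      "Id C (Cod C e) \<cdot> x = Id C (Cod C e) \<cdot> y"
    then show "x = y" using O by (simp add: Hom_def)
  qed (use O in simp)
  moreover have "is_pullback C g (Id C (Dom C g)) (Id C (Cod C e)) g"
  proof (rule pullbackI)
    fix a b assume ab: "a \<in> Arr C" "b \<in> Arr C" "Cod C a = Dom C (Id C (Cod C e))" "Cod C b = Dom C g"
      "Dom C a = Dom C b" "Id C (Cod C e) \<cdot> a = g \<cdot> b"
    have gb: "g \<cdot> b = a" using ab(1,3,6) O by simp
    show "\<exists>!h. h \<in> Hom C (Dom C a) (Dom C g) \<and> g \<cdot> h = a \<and> Id C (Dom C g) \<cdot> h = b"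
    proof (rule ex1I[of _ b])
      show "b \<in> Hom C (Dom C a) (Dom C g) \<and> g \<cdot> b = a \<and> Id C (Dom C g) \<cdot> b = b"
        using ab(2,4,5) gb by (simp add: Hom_def)
      show "h = b" if "h \<in> Hom C (Dom C a) (Dom C g) \<and> g \<cdot> h = a \<and> Id C (Dom C g) \<cdot> h = b" for h
        using that by (auto simp: Hom_def)
    qed
  qed (use O P(1,2,5) in simp_all)
  ultimately show ?thesis using factorisations_stable[OF _ e _ _ pb] O by simp
qed

text \<open>Pulling back along \<open>p \<cdot> m \<cdot> e\<close> makes the projections split, by \<open>e\<close> and \<open>m \<cdot> e\<close>,
  so that the split short five lemma applies to the pullback of \<open>m\<close>.\<close>

lemma mono_iso_if_same_kernel:
  assumes m: "is_mono C m" and p: "p \<in> Arr C" "Dom C p = Cod C m"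
    and e: "e \<in> Arr C" "Cod C e = Dom C m" and re: "is_regular_epi C (p \<cdot> (m \<cdot> e))"
    and c: "c \<in> Arr C" "Cod C c = Dom C m" and k: "is_kernel C (m \<cdot> c) p"
  shows "is_iso C m"
proof -
  have M: "m \<in> Arr C" using m by (simp add: is_mono_def)
  have k': "is_kernel C c (p \<cdot> m)" by (rule kernel_comp_mono[OF m c k])
  define r where "r = p \<cdot> (m \<cdot> e)"
  have r: "r \<in> Arr C" "Dom C r = Dom C e" "Cod C r = Cod C p" "is_regular_epi C r"
    using re p e M by (simp_all add: r_def)
  obtain p1 q1 where pb1: "is_pullback C p1 q1 (p \<cdot> m) r"
    by (rule pullbacks[of "p \<cdot> m" r]) (use r p M in simp_all)
  obtain p2 q2 where pb2: "is_pullback C p2 q2 p r"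
    by (rule pullbacks[of p r]) (use r p in simp_all)
  note P1 = pullbackD[OF pb1] and P2 = pullbackD[OF pb2]
  have D1: "Cod C p1 = Dom C m" "Cod C q1 = Dom C e" "Cod C p2 = Cod C m" "Cod C q2 = Dom C e"
    using P1(7,8) P2(7,8) p r M by simp_all
  have "p \<cdot> (m \<cdot> p1) = r \<cdot> q1" unfolding P1(9)[symmetric] using P1(3) D1 p M by simp
  \<comment> \<open>\<open>w\<close> is the arrow that \<open>m\<close> induces from the pullback of
    \<open>p \<cdot> m\<close> to that of \<open>p\<close>, over the common base
    \<open>Dom C e\<close>.\<close>
  then obtain w where w: "w \<in> Arr C" "Dom C w = Dom C p1" "Cod C w = Dom C p2" "p2 \<cdot> w = m \<cdot> p1" "q2 \<cdot> w = q1"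
    using pullback_lift[OF pb2, of "m \<cdot> p1" q1] P1(3,4,6) D1 p r M by auto
  obtain s where s: "s \<in> Arr C" "Dom C s = Dom C e" "Cod C s = Dom C p1" "p1 \<cdot> s = e" "q1 \<cdot> s = Id C (Dom C e)"
    using pullback_lift[OF pb1, of e "Id C (Dom C e)"] D1 p e M r by (auto simp: r_def)
  obtain z where z: "z \<in> Arr C" "Dom C z = Dom C c" "Cod C z = Dom C e" "is_zero_arrow C z"
    using zero_arrow_exists[of "Dom C c" "Dom C e"] c e by auto
  have pmc: "is_zero_arrow C (p \<cdot> (m \<cdot> c))" by (rule kernelD(4)[OF k])
  have "p \<cdot> (m \<cdot> c) = r \<cdot> z"
    using zero_arrow_unique[OF pmc zero_arrow_comp_left[OF z(4), of r]] z p r M c by simp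
  \<comment> \<open>With components \<open>c\<close> and zero, \<open>d\<close> is the kernel of
    \<open>q1\<close>; likewise \<open>w \<cdot> d\<close>, with components
    \<open>m \<cdot> c\<close> and zero, is the kernel of \<open>q2\<close>.\<close>
  then obtain d where d: "d \<in> Arr C" "Dom C d = Dom C c" "Cod C d = Dom C p1" "p1 \<cdot> d = c" "q1 \<cdot> d = z"
    using pullback_lift[OF pb1, of c z] D1 p r M c z by auto
  have d1: "is_kernel C d (q2 \<cdot> w)"
    unfolding w(5) using kernel_of_pullback[OF pb1 k', of d] d z by simp
  have "p2 \<cdot> (w \<cdot> d) = m \<cdot> c"
    using comp_reassoc[OF w(4), of d] d w P1(3,4,6) P2(3,4,6) D1 M by simp
  moreover have "q2 \<cdot> (w \<cdot> d) = z"
    using comp_reassoc1[OF w(5), of d] d w P1(3,4,6) P2(3,4,6) D1 M by simp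
  ultimately have d2: "is_kernel C (w \<cdot> d) q2"
    using kernel_of_pullback[OF pb2 k, of "w \<cdot> d"] d w z by simp
  have "is_section_of C s (q2 \<cdot> w)"
    unfolding w(5) using s D1 P1(3,4,6) r by (simp add: is_section_of_def Hom_def)
  then have "is_iso C w"
    using iso_if_same_kernel[OF w(1) _ _ d1 d2] w P2(4,6) by simp
  then obtain v where v: "v \<in> Arr C" "Dom C v = Dom C p2" "Cod C v = Dom C p1" "w \<cdot> v = Id C (Dom C p2)"
    using w by (auto elim: isoE)
  \<comment> \<open>Invertibility of \<open>w\<close> makes \<open>p2\<close> factor through
    \<open>m\<close>, and \<open>p2\<close> is a regular epimorphism as the pullback of
    \<open>r\<close> along \<open>p\<close>.\<close>
  have "m \<cdot> (p1 \<cdot> v) = p2"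
    using comp_reassoc[OF w(4), of v] v w P1(3,4,6) P2(3,4,6) D1 M by simp
  moreover have "is_regular_epi C p2"
    by (rule regular_epi_pullback[OF r(4) pullback_swap[OF pb2]])
  ultimately show ?thesis
    using iso_if_regular_epi_factors[OF m, of "p1 \<cdot> v"] v P1(3) D1 M by simp
qed

text \<open>By the split short five lemma, \<open>g\<close> and \<open>h \<cdot> g\<close> have the same kernel pair.\<close>

lemma factor_through_regular_epi:
  assumes g: "g \<in> Arr C" and h: "h \<in> Arr C" "Dom C h = Cod C g"
    and re: "is_regular_epi C (h \<cdot> g)"
    and t: "is_kernel C t g" and t': "is_kernel C t (h \<cdot> g)"
  obtains x where "x \<in> Arr C" "Dom C x = Cod C h" "Cod C x = Cod C g" "x \<cdot> (h \<cdot> g) = g"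
proof -
  define r where "r = h \<cdot> g"
  have r: "r \<in> Arr C" "Dom C r = Dom C g" "Cod C r = Cod C h" "is_regular_epi C r" "is_kernel C t r"
    using re t' g h by (simp_all add: r_def)
  obtain p1 q1 where pb1: "is_pullback C p1 q1 g g" by (rule pullbacks[of g g]) (use g in simp_all)
  obtain p2 q2 where pb2: "is_pullback C p2 q2 r r" by (rule pullbacks[of r r]) (use r in simp_all)
  note P1 = pullbackD[OF pb1] and P2 = pullbackD[OF pb2] and T = kernelD[OF t]
  have D1: "Cod C p1 = Dom C g" "Cod C q1 = Dom C g" "Cod C p2 = Dom C g" "Cod C q2 = Dom C g"
    using P1(7,8) P2(7,8) r by simp_all
  have rp: "r \<cdot> p1 = r \<cdot> q1" using P1(3,4,9) D1 g h by (simp add: r_def)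
  \<comment> \<open>\<open>w\<close> compares the kernel pair of \<open>g\<close> with that of
    \<open>r\<close>; the diagonal \<open>s\<close> of the former will split
    \<open>q2 \<cdot> w\<close>.\<close>
  obtain w where w: "w \<in> Arr C" "Dom C w = Dom C p1" "Cod C w = Dom C p2" "p2 \<cdot> w = p1" "q2 \<cdot> w = q1"
    using pullback_lift[OF pb2, of p1 q1] P1(3,4,6) D1 r rp by auto
  obtain s where s: "s \<in> Arr C" "Dom C s = Dom C g" "Cod C s = Dom C p1" "q1 \<cdot> s = Id C (Dom C g)"
    using pullback_lift[OF pb1, of "Id C (Dom C g)" "Id C (Dom C g)"] D1 g by auto
  obtain z where z: "z \<in> Arr C" "Dom C z = Dom C t" "Cod C z = Dom C g" "is_zero_arrow C z"
    using zero_arrow_exists[of "Dom C t" "Dom C g"] T g by auto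
  have "g \<cdot> t = g \<cdot> z"
    using zero_arrow_unique[OF T(4) zero_arrow_comp_left[OF z(4), of g]] z T(1-3) g by simp
  then obtain d where d: "d \<in> Arr C" "Dom C d = Dom C t" "Cod C d = Dom C p1" "p1 \<cdot> d = t" "q1 \<cdot> d = z"
    using pullback_lift[OF pb1, of t z] D1 T(1,3) z by auto
  have d1: "is_kernel C d (q2 \<cdot> w)"
    unfolding w(5) using kernel_of_pullback[OF pb1 t, of d] d z by simp
  have "p2 \<cdot> (w \<cdot> d) = t" "q2 \<cdot> (w \<cdot> d) = z"
    using comp_reassoc1[OF w(4), of d] comp_reassoc1[OF w(5), of d] d w P1(3,4,6) P2(3,4,6) D1 by simp_all
  then have d2: "is_kernel C (w \<cdot> d) q2"
    using kernel_of_pullback[OF pb2 r(5), of "w \<cdot> d"] d w z by simp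
  have "is_section_of C s (q2 \<cdot> w)"
    unfolding w(5) using s D1 P1(3,4,6) by (simp add: is_section_of_def Hom_def)
  then have "is_iso C w"
    using iso_if_same_kernel[OF w(1) _ _ d1 d2] w P2(4,6) r by simp
  then obtain v where v: "v \<in> Arr C" "Dom C v = Dom C p2" "Cod C v = Dom C p1" "w \<cdot> v = Id C (Dom C p2)"
    using w by (auto elim: isoE)
  have "p2 \<cdot> (w \<cdot> v) = p1 \<cdot> v"
    by (rule comp_reassoc1[OF w(4)]) (use v w P2(3) in simp_all)
  moreover have "q2 \<cdot> (w \<cdot> v) = q1 \<cdot> v"
    by (rule comp_reassoc1[OF w(5)]) (use v w P2(4,6) in simp_all)
  ultimately have pv: "p1 \<cdot> v = p2" "q1 \<cdot> v = q2"
    unfolding v(4) using P2(3,4,6) by simp_all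
  have gp: "g \<cdot> p2 = g \<cdot> q2"
    using comp_reassoc[OF P1(9), of v] v P1(3,4,6) D1 pv g by simp
  \<comment> \<open>The pair with coequaliser \<open>r\<close> factors through the kernel pair of
    \<open>r\<close> by \<open>y\<close>. As \<open>g\<close> has equal composites with
    \<open>p2\<close> and \<open>q2\<close>, it has equal composites with \<open>a\<close> and
    \<open>b\<close>.\<close>
  obtain a b where co: "is_coequalizer C r a b" using r(4) by (auto simp: is_regular_epi_def)
  note E = coequalizerD[OF co]
  obtain y where y: "y \<in> Arr C" "Dom C y = Dom C a" "Cod C y = Dom C p2" "p2 \<cdot> y = a" "q2 \<cdot> y = b"
    using pullback_lift[OF pb2, of a b] E r by auto
  have "g \<cdot> (p2 \<cdot> y) = g \<cdot> (q2 \<cdot> y)"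
    by (rule comp_reassoc[OF gp]) (use y P2(3,4,6) D1 g in simp_all)
  then have "\<exists>x. x \<in> Arr C \<and> Dom C x = Cod C r \<and> Cod C x = Cod C g \<and> x \<cdot> r = g"
    using coequalizer_factor[OF co, of g] y g r by simp
  then show thesis using that r by (auto simp: r_def)
qed

end

section \<open>The reflection of a torsion theory\<close>

text \<open>The conditions of \<open>reflector\<close> are spelled out with a fixed unit
  \<open>\<eta>\<close>, so that all lemmas refer to the same one.\<close>

locale torsion_reflection = homological_category C
  for C :: "('o, 'a, 'x) precategory_scheme" (structure) +
  fixes \<T> \<F> :: "'o set" and R :: "('o, 'a, 'o, 'a) prefunctor" and \<eta> :: "'o \<Rightarrow> 'a"
  assumes torsion: "torsion_theory C \<T> \<F>"
    and functorial: "is_functor C (full_subcategory C \<F>) R"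
    and unit_Hom: "A \<in> Obj C \<Longrightarrow> \<eta> A \<in> Hom C A (FObj R A)"
    and naturality: "f \<in> Hom C A B \<Longrightarrow> FArr R f \<cdot> \<eta> A = \<eta> B \<cdot> f"
    and universality: "\<lbrakk> A \<in> Obj C; X \<in> \<F>; f \<in> Hom C A X \<rbrakk>
      \<Longrightarrow> \<exists>!h. h \<in> Hom C (FObj R A) X \<and> h \<cdot> \<eta> A = f"
begin

lemma torsion_free_Obj: "\<F> \<subseteq> Obj C"
  using torsion by (simp add: torsion_theory_def replete_def)

lemma torsion_iso_closed:
  assumes "is_iso C f"
  shows "Dom C f \<in> \<T> \<Longrightarrow> Cod C f \<in> \<T>" "Dom C f \<in> \<F> \<Longrightarrow> Cod C f \<in> \<F>"
  using torsion assms unfolding torsion_theory_def replete_def by blast+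

lemma zero_arrow_torsion:
  assumes "f \<in> Arr C" "Dom C f \<in> \<T>" "Cod C f \<in> \<F>"
  shows "is_zero_arrow C f"
  using torsion assms unfolding torsion_theory_def Hom_def by blast

lemma unit [simp]:
  assumes "A \<in> Obj C"
  shows "\<eta> A \<in> Arr C" "Dom C (\<eta> A) = A" "Cod C (\<eta> A) = FObj R A"
  using unit_Hom[OF assms] by (simp_all add: Hom_def)

lemma reflection_torsion_free [simp]: "A \<in> Obj C \<Longrightarrow> FObj R A \<in> \<F>"
  using functorial by (simp add: is_functor_def full_subcategory_def)

lemma reflection_Obj [simp]: "A \<in> Obj C \<Longrightarrow> FObj R A \<in> Obj C"
  using torsion_free_Obj reflection_torsion_free by blast

lemma FArr [simp]:
  assumes "f \<in> Arr C"
  shows "FArr R f \<in> Arr C" "Dom C (FArr R f) = FObj R (Dom C f)" "Cod C (FArr R f) = FObj R (Cod C f)"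
proof -
  have "f \<in> Hom C (Dom C f) (Cod C f)" using assms by (simp add: Hom_def)
  then have "FArr R f \<in> Hom (full_subcategory C \<F>) (FObj R (Dom C f)) (FObj R (Cod C f))"
    using functorial unfolding is_functor_def by blast
  then show "FArr R f \<in> Arr C" "Dom C (FArr R f) = FObj R (Dom C f)"
    "Cod C (FArr R f) = FObj R (Cod C f)"
    by (simp_all add: Hom_def full_subcategory_def)
qed

lemma FArr_comp:
  assumes "f \<in> Arr C" "g \<in> Arr C" "Cod C f = Dom C g"
  shows "FArr R (g \<cdot> f) = FArr R g \<cdot> FArr R f"
proof -
  have "f \<in> Hom C (Dom C f) (Dom C g)" "g \<in> Hom C (Dom C g) (Cod C g)"
    using assms by (simp_all add: Hom_def)
  then have "FArr R (g \<cdot> f) = FArr R g \<cdot>\<^bsub>full_subcategory C \<F>\<^esub> FArr R f"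
    using functorial unfolding is_functor_def by blast
  then show ?thesis by (simp add: full_subcategory_def)
qed

lemma FArr_Id: "A \<in> Obj C \<Longrightarrow> FArr R (Id C A) = Id C (FObj R A)"
  using functorial by (simp add: is_functor_def full_subcategory_def)

lemma FArr_unit:
  assumes "f \<in> Arr C" "Dom C f = A" "Cod C f = B"
  shows "FArr R f \<cdot> \<eta> A = \<eta> B \<cdot> f"
  using naturality[of f A B] assms by (simp add: Hom_def)

lemma unit_cancel:
  assumes "A \<in> Obj C" "g \<cdot> \<eta> A = h \<cdot> \<eta> A" "g \<in> Arr C" "h \<in> Arr C"
    "Dom C g = FObj R A" "Dom C h = FObj R A" "Cod C g = Cod C h" "Cod C h \<in> \<F>"
  shows "g = h"
proof -
  have gh: "g \<in> Hom C (FObj R A) (Cod C h)" "h \<in> Hom C (FObj R A) (Cod C h)"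
    using assms by (simp_all add: Hom_def)
  have "h \<cdot> \<eta> A \<in> Hom C A (Cod C h)" using assms by (simp add: Hom_def)
  from universality[OF assms(1,8) this] show ?thesis using gh assms(2) by metis
qed

text \<open>\<open>\<eta> A\<close> need not be the arrow \<open>q\<close> of the exact sequence
  supplied by the torsion theory. The universal properties give \<open>i\<close> and
  \<open>j\<close> between their codomains, and \<open>j \<cdot> i\<close> being the identity
  suffices to carry the kernel and the universal property of \<open>q\<close> over to
  \<open>\<eta> A\<close>.\<close>

lemma unit_exact:
  assumes A: "A \<in> Obj C"
  obtains t where "is_kernel C t (\<eta> A)" "Dom C t \<in> \<T>" "is_regular_epi C (\<eta> A)"
proof -
  obtain T X t q where TX: "T \<in> \<T>" "X \<in> \<F>" and tq: "t \<in> Hom C T A" "q \<in> Hom C A X" "short_exact C t q"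
    using torsion A unfolding torsion_theory_def by meson
  have t: "t \<in> Arr C" "Dom C t = T" "Cod C t = A" and q: "q \<in> Arr C" "Dom C q = A" "Cod C q = X"
    using tq by (simp_all add: Hom_def)
  have ker: "is_kernel C t q" and cok: "is_cokernel C q t"
    using tq(3) by (simp_all add: short_exact_def)
  have cok_ex1: "\<exists>!h. h \<in> Hom C X Y \<and> h \<cdot> q = g"
    if "g \<in> Hom C A Y" "is_zero_arrow C (g \<cdot> t)" for g Y
    using cok that t q unfolding is_cokernel_def by blast
  obtain i where i: "i \<in> Arr C" "Dom C i = FObj R A" "Cod C i = X" "i \<cdot> \<eta> A = q"
    using universality[OF A TX(2) tq(2)] by (auto simp: Hom_def)
  have et: "is_zero_arrow C (\<eta> A \<cdot> t)"
    by (rule zero_arrow_torsion) (use t TX A in simp_all)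
  obtain j where j: "j \<in> Arr C" "Dom C j = X" "Cod C j = FObj R A" "j \<cdot> q = \<eta> A"
    using cok_ex1[OF unit_Hom[OF A] et] by (auto simp: Hom_def)
  have ji: "j \<cdot> i = Id C (FObj R A)"
    by (rule unit_cancel[OF A]) (use i j A in simp_all)
  have kernel: "is_kernel C t (\<eta> A)"
  proof (rule kernelI)
    show "is_mono C t" by (rule kernel_is_mono[OF ker])
    fix g assume g: "g \<in> Arr C" "Cod C g = Dom C (\<eta> A)" "is_zero_arrow C (\<eta> A \<cdot> g)"
    then have "is_zero_arrow C (i \<cdot> (\<eta> A \<cdot> g))"
      using zero_arrow_comp_left[OF g(3), of i] i A by simp
    then have "is_zero_arrow C (q \<cdot> g)" using comp_reassoc1[OF i(4), of g] g i A by simp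
    then show "\<exists>h. h \<in> Arr C \<and> Dom C h = Dom C g \<and> Cod C h = Dom C t \<and> t \<cdot> h = g"
      using kernel_lift[OF ker, of g] g q A by simp
  qed (use t A et in simp_all)
  obtain z where z: "z \<in> Arr C" "Dom C z = T" "Cod C z = A" "is_zero_arrow C z"
    using zero_arrow_exists[of T A] t A by auto
  \<comment> \<open>Being a cokernel of \<open>t\<close> means being a coequaliser of
    \<open>t\<close> and the zero arrow \<open>z\<close>, hence a regular epimorphism.\<close>
  have "is_coequalizer C (\<eta> A) t z"
    unfolding is_coequalizer_def
  proof (intro conjI allI ballI impI)
    show "\<eta> A \<cdot> t = \<eta> A \<cdot> z"
      using zero_arrow_unique[OF et zero_arrow_comp_left[OF z(4), of "\<eta> A"]] z t A by simp
    fix Y g assume g: "g \<in> Hom C (Dom C (\<eta> A)) Y" "g \<cdot> t = g \<cdot> z"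
    have gA: "g \<in> Arr C" "Dom C g = A" "Cod C g = Y" using g A by (simp_all add: Hom_def)
    have "is_zero_arrow C (g \<cdot> t)"
      unfolding g(2) using zero_arrow_comp_left[OF z(4), of g] gA z by simp
    then have ex1: "\<exists>!h. h \<in> Hom C X Y \<and> h \<cdot> q = g" using cok_ex1[of g Y] gA by (simp add: Hom_def)
    then obtain h where h: "h \<in> Arr C" "Dom C h = X" "Cod C h = Y" "h \<cdot> q = g"
      by (auto simp: Hom_def)
    show "\<exists>!h. h \<in> Hom C (Cod C (\<eta> A)) Y \<and> h \<cdot> \<eta> A = g"
    proof (rule ex1I[of _ "h \<cdot> i"])
      show "h \<cdot> i \<in> Hom C (Cod C (\<eta> A)) Y \<and> (h \<cdot> i) \<cdot> \<eta> A = g"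
        using h i A by (simp add: Hom_def)
      fix h' assume h': "h' \<in> Hom C (Cod C (\<eta> A)) Y \<and> h' \<cdot> \<eta> A = g"
      then have hA: "h' \<in> Arr C" "Dom C h' = FObj R A" "Cod C h' = Y" "h' \<cdot> \<eta> A = g"
        using A by (simp_all add: Hom_def)
      have "h' \<cdot> j \<in> Hom C X Y \<and> (h' \<cdot> j) \<cdot> q = g" "h \<in> Hom C X Y \<and> h \<cdot> q = g"
        using hA h j q by (simp_all add: Hom_def)
      then have "h' \<cdot> j = h" using ex1 by blast
      then have "h \<cdot> i = h' \<cdot> (j \<cdot> i)" using hA j i by auto
      then show "h' = h \<cdot> i" using ji hA by simp
    qed
  qed (use t z A in \<open>simp_all add: Hom_def\<close>)
  then have "is_regular_epi C (\<eta> A)" by (auto simp: is_regular_epi_def)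
  then show thesis using that kernel t TX by blast
qed

text \<open>If \<open>\<eta> A\<close> is zero, the identity of \<open>A\<close> factors through its
  kernel \<open>t\<close>, so \<open>t\<close> is invertible and \<open>A\<close> is isomorphic to
  the torsion object \<open>Dom C t\<close>.\<close>

lemma torsion_iff_unit_zero:
  assumes A: "A \<in> Obj C"
  shows "A \<in> \<T> \<longleftrightarrow> is_zero_arrow C (\<eta> A)"
proof
  assume "A \<in> \<T>"
  then show "is_zero_arrow C (\<eta> A)" using zero_arrow_torsion[of "\<eta> A"] A by simp
next
  assume z: "is_zero_arrow C (\<eta> A)"
  obtain t where t: "is_kernel C t (\<eta> A)" "Dom C t \<in> \<T>" by (rule unit_exact[OF A])
  note K = kernelD[OF t(1)]
  have CA: "Cod C t = A" using K A by simp
  obtain h where h: "h \<in> Arr C" "Dom C h = A" "Cod C h = Dom C t" "t \<cdot> h = Id C A"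
    using kernel_lift[OF t(1), of "Id C A"] z A by auto
  have "t \<cdot> (h \<cdot> t) = t \<cdot> Id C (Dom C t)" using comp_reassoc1[OF h(4), of t] h K CA by simp
  then have "h \<cdot> t = Id C (Dom C t)"
    using mono_cancel[OF kernel_is_mono[OF t(1)], of "h \<cdot> t" "Id C (Dom C t)"] h K CA by simp
  then have "is_iso C t" using isoI[of t h] h K CA by simp
  then show "A \<in> \<T>" using torsion_iso_closed(1)[of t] t(2) CA by simp
qed

text \<open>By naturality \<open>FArr R f\<close> and the zero arrow parallel to it agree after
  composition with the unit, which determines arrows from a reflection to a torsion-free
  object.\<close>

lemma FArr_zero:
  assumes f: "is_zero_arrow C f"
  shows "is_zero_arrow C (FArr R f)"
proof -
  have fA: "f \<in> Arr C" using f by (simp add: is_zero_arrow_def)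
  obtain z where z: "z \<in> Arr C" "Dom C z = FObj R (Dom C f)" "Cod C z = FObj R (Cod C f)" "is_zero_arrow C z"
    using zero_arrow_exists[of "FObj R (Dom C f)" "FObj R (Cod C f)"] fA by auto
  have nat: "FArr R f \<cdot> \<eta> (Dom C f) = \<eta> (Cod C f) \<cdot> f" using FArr_unit[of f] fA by simp
  have "is_zero_arrow C (\<eta> (Cod C f) \<cdot> f)" "is_zero_arrow C (z \<cdot> \<eta> (Dom C f))"
    using zero_arrow_comp_left[OF f, of "\<eta> (Cod C f)"]
      zero_arrow_comp_right[OF z(4), of "\<eta> (Dom C f)"] fA z by simp_all
  then have "FArr R f \<cdot> \<eta> (Dom C f) = z \<cdot> \<eta> (Dom C f)"
    unfolding nat by (rule zero_arrow_unique) (use fA z in simp_all)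
  then have "FArr R f = z" using unit_cancel[of "Dom C f" "FArr R f" z] fA z by simp
  then show ?thesis using z(4) by simp
qed

text \<open>Needed to identify zero arrows of the subcategory with those of \<open>C\<close>. The
  unit at \<open>Z\<close> is invertible: one composite is an endomorphism of the initial object,
  the other is tested on the unit, again by arrows out of \<open>Z\<close>.\<close>

lemma zero_object_torsion_free:
  assumes Z: "is_zero_object C Z"
  shows "Z \<in> \<F>"
proof -
  have ZO: "Z \<in> Obj C" using Z by (simp add: is_zero_object_def is_initial_def)
  obtain h where h: "h \<in> Arr C" "Dom C h = FObj R Z" "Cod C h = Z"
    using zero_object_hom(1)[OF Z, of "FObj R Z"] ZO by (auto simp: Hom_def)
  have init: "x = y" if "x \<in> Arr C" "y \<in> Arr C" "Dom C x = Z" "Dom C y = Z" "Cod C x = Cod C y" for x y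
    using zero_object_hom(2)[OF Z, of "Cod C y"] that by (auto simp: Hom_def)
  have "h \<cdot> \<eta> Z = Id C Z" by (rule init) (use h ZO in simp_all)
  moreover have "\<eta> Z \<cdot> h = Id C (FObj R Z)"
    by (rule unit_cancel[OF ZO], rule init) (use h ZO in simp_all)
  ultimately have "is_iso C h" using isoI[of h "\<eta> Z"] h ZO by simp
  then show ?thesis using torsion_iso_closed(2)[of h] h ZO by simp
qed

lemma full_subcategory_simps:
  "Obj (full_subcategory C \<F>) = \<F>" "Dom (full_subcategory C \<F>) = Dom C"
  "Cod (full_subcategory C \<F>) = Cod C" "Id (full_subcategory C \<F>) = Id C"
  "Cmp (full_subcategory C \<F>) = Cmp C"
  "Arr (full_subcategory C \<F>) = {f \<in> Arr C. Dom C f \<in> \<F> \<and> Cod C f \<in> \<F>}"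
  by (simp_all add: full_subcategory_def)

section \<open>Protoadditivity implies heredity\<close>

lemma hereditary_if_protoadditive:
  assumes pa: "protoadditive C (full_subcategory C \<F>) R"
  shows "hereditary C (protosplit_monos C) \<T>"
  unfolding hereditary_def
proof (intro ballI impI)
  let ?D = "full_subcategory C \<F>"
  interpret D: category ?D by (rule category_full_subcategory[OF torsion_free_Obj])
  fix m assume "m \<in> protosplit_monos C" and A: "Cod C m \<in> \<T>"
  then obtain f s where k: "is_kernel C m f" and s: "is_section_of C s f"
    unfolding protosplit_monos_def is_split_epi_def by blast
  then have "is_kernel ?D (FArr R m) (FArr R f)"
    using pa unfolding protoadditive_def split_short_exact_def by blast
  note mono = D.kernel_is_mono[OF this]
  let ?K = "Dom C m"
  have m: "m \<in> Arr C" by (rule kernelD[OF k])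
  have nat: "FArr R m \<cdot> \<eta> ?K = \<eta> (Cod C m) \<cdot> m" using FArr_unit[of m] m by simp
  have "is_zero_arrow C (\<eta> (Cod C m))" using torsion_iff_unit_zero[of "Cod C m"] A m by simp
  then have Fm_unit: "is_zero_arrow C (FArr R m \<cdot> \<eta> ?K)"
    unfolding nat using m by (intro zero_arrow_comp_right) simp_all
  obtain w where w: "w \<in> Arr C" "Dom C w = FObj R ?K" "Cod C w = FObj R (Cod C m)" "is_zero_arrow C w"
    using zero_arrow_exists[of "FObj R ?K" "FObj R (Cod C m)"] m by auto
  have "FArr R m \<cdot> \<eta> ?K = w \<cdot> \<eta> ?K"
    by (rule zero_arrow_unique[OF Fm_unit zero_arrow_comp_right[OF w(4)]]) (use m w in simp_all)
  \<comment> \<open>\<open>FArr R m\<close> is thus the zero arrow \<open>w\<close>, while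
    protoadditivity makes it a monomorphism of the subcategory.\<close>
  then have Fm: "FArr R m = w" using unit_cancel[of ?K "FArr R m" w] m w by simp
  obtain z where z: "z \<in> Arr C" "Dom C z = FObj R ?K" "Cod C z = FObj R ?K" "is_zero_arrow C z"
    using zero_arrow_exists[of "FObj R ?K" "FObj R ?K"] m by auto
  \<comment> \<open>The zero endomorphism \<open>z\<close> and the identity of
    \<open>FObj R ?K\<close> become equal after the monomorphism \<open>w\<close>, so they coincide;
    hence the unit at \<open>?K\<close> is zero.\<close>
  have wz: "w \<cdot> z = w"
    by (rule zero_arrow_unique[OF zero_arrow_comp_left[OF z(4)] w(4)]) (use w z in simp_all)
  have "z = Id C (FObj R ?K)"
    by (rule D.mono_cancel[OF mono]) (use wz w z m Fm in \<open>simp_all add: full_subcategory_simps\<close>)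
  then have "is_zero_arrow C (Id C (FObj R ?K) \<cdot> \<eta> ?K)"
    using zero_arrow_comp_right[OF z(4), of "\<eta> ?K"] z m by simp
  then show "?K \<in> \<T>" using torsion_iff_unit_zero[of ?K] m by simp
qed

section \<open>Kernels of split epimorphisms under the reflector\<close>

text \<open>The kernel is first identified in \<open>C\<close>, where the pullbacks and regular
  epimorphisms of the argument live; the passage to the subcategory comes afterwards.\<close>

lemma reflection_kernel:
  assumes her: "hereditary C (protosplit_monos C) \<T>"
    and k: "is_kernel C k f" and s: "is_section_of C s f"
  shows "is_kernel C (FArr R k) (FArr R f)"
proof -
  define A B K where "A = Dom C f" and "B = Cod C f" and "K = Dom C k"
  have f: "f \<in> Arr C" "Dom C f = A" "Cod C f = B"
    using kernelD[OF k] by (simp_all add: A_def B_def)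
  have kA: "k \<in> Arr C" "Dom C k = K" "Cod C k = A" and fk: "is_zero_arrow C (f \<cdot> k)"
    using kernelD[OF k] by (simp_all add: A_def K_def)
  have sA: "s \<in> Arr C" "Dom C s = B" "Cod C s = A" "f \<cdot> s = Id C B"
    using s f unfolding is_section_of_def by (simp_all add: Hom_def)
  have O: "A \<in> Obj C" "B \<in> Obj C" "K \<in> Obj C"
    using f kA Dom_in_Obj Cod_in_Obj by auto
  have Ff: "FArr R f \<in> Arr C" "Dom C (FArr R f) = FObj R A" "Cod C (FArr R f) = FObj R B"
    using f by simp_all
  have Fk: "FArr R k \<in> Arr C" "Dom C (FArr R k) = FObj R K" "Cod C (FArr R k) = FObj R A"
    using kA by simp_all
  have nat_f: "FArr R f \<cdot> \<eta> A = \<eta> B \<cdot> f" using FArr_unit f by blast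
  have nat_k: "FArr R k \<cdot> \<eta> K = \<eta> A \<cdot> k" using FArr_unit kA by blast
  obtain tA where tA: "is_kernel C tA (\<eta> A)" "Dom C tA \<in> \<T>" and regA: "is_regular_epi C (\<eta> A)"
    by (rule unit_exact[OF O(1)])
  obtain tB where tB: "is_kernel C tB (\<eta> B)" "Dom C tB \<in> \<T>"
    by (rule unit_exact[OF O(2)])
  obtain tK where tK: "is_kernel C tK (\<eta> K)" "Dom C tK \<in> \<T>" and regK: "is_regular_epi C (\<eta> K)"
    by (rule unit_exact[OF O(3)])
  have tAA: "tA \<in> Arr C" "Cod C tA = A" and tBA: "tB \<in> Arr C" "Cod C tB = B"
    and tKA: "tK \<in> Arr C" "Cod C tK = K"
    using kernelD[OF tA(1)] kernelD[OF tB(1)] kernelD[OF tK(1)] O by simp_all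

  \<comment> \<open>Arrows from torsion objects are killed by the units, so \<open>f\<close> and
    \<open>s\<close> restrict to arrows \<open>f'\<close> and \<open>s'\<close> between the torsion
    parts \<open>Dom C tA\<close> and \<open>Dom C tB\<close>.\<close>
  have "is_zero_arrow C (\<eta> B \<cdot> (f \<cdot> tA))"
    by (rule zero_arrow_torsion) (use f tAA tA(2) O in simp_all)
  then obtain f' where f': "f' \<in> Arr C" "Dom C f' = Dom C tA" "Cod C f' = Dom C tB" "tB \<cdot> f' = f \<cdot> tA"
    using kernel_lift[OF tB(1), of "f \<cdot> tA"] f tAA O by auto
  have "is_zero_arrow C (\<eta> A \<cdot> (s \<cdot> tB))"
    by (rule zero_arrow_torsion) (use sA tBA tB(2) O in simp_all)
  then obtain s' where s': "s' \<in> Arr C" "Dom C s' = Dom C tB" "Cod C s' = Dom C tA" "tA \<cdot> s' = s \<cdot> tB"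
    using kernel_lift[OF tA(1), of "s \<cdot> tB"] sA tBA O by auto
  \<comment> \<open>This makes \<open>f'\<close> a split epimorphism here, and later shows that the
    image of \<open>d\<close> contains the kernel of \<open>p\<close>.\<close>
  have ftAs: "f \<cdot> (tA \<cdot> s') = tB"
    unfolding s'(4) using comp_reassoc1[OF sA(4), of tB] sA f tBA by simp
  have "tB \<cdot> (f' \<cdot> s') = f \<cdot> (tA \<cdot> s')"
    by (rule comp_reassoc[OF f'(4)]) (use f' s' f tAA tBA in simp_all)
  then have "tB \<cdot> (f' \<cdot> s') = tB \<cdot> Id C (Dom C tB)" using ftAs tBA by simp
  then have f's': "f' \<cdot> s' = Id C (Dom C tB)"
    using mono_cancel[OF kernel_is_mono[OF tB(1)], of "f' \<cdot> s'" "Id C (Dom C tB)"] f' s' tBA by simp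
  have split: "is_split_epi C f'"
    using f' s' f's' unfolding is_split_epi_def is_section_of_def by (auto simp: Hom_def)
  obtain n where n: "is_kernel C n f'" by (rule kernel_exists[OF f'(1)])
  have nA: "n \<in> Arr C" "Cod C n = Dom C tA" using kernelD[OF n] f' by simp_all
  \<comment> \<open>Heredity enters here: \<open>n\<close> is a protosplit monomorphism into the
    torsion object \<open>Dom C tA\<close>.\<close>
  have "n \<in> protosplit_monos C"
    using n split kernel_is_mono[OF n] unfolding protosplit_monos_def by blast
  then have nT: "Dom C n \<in> \<T>" using her tA(2) nA unfolding hereditary_def by auto

  \<comment> \<open>The claim amounts to invertibility of the comparison \<open>\<psi>\<close> from
    \<open>FObj R K\<close> to the domain of the actual kernel \<open>l\<close> of
    \<open>FArr R f\<close>.\<close>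
  obtain l where l: "is_kernel C l (FArr R f)" by (rule kernel_exists[OF Ff(1)])
  define L where "L = Dom C l"
  have lA: "l \<in> Arr C" "Dom C l = L" "Cod C l = FObj R A" and Fl: "is_zero_arrow C (FArr R f \<cdot> l)"
    using kernelD[OF l] Ff by (simp_all add: L_def)
  have l_mono: "is_mono C l" by (rule kernel_is_mono[OF l])
  have "is_zero_arrow C (FArr R f \<cdot> FArr R k)"
    using FArr_zero[OF fk] FArr_comp[of k f] f kA by simp
  then obtain \<psi> where \<psi>: "\<psi> \<in> Arr C" "Dom C \<psi> = FObj R K" "Cod C \<psi> = L" "l \<cdot> \<psi> = FArr R k"
    using kernel_lift[OF l, of "FArr R k"] Fk Ff lA by auto
  define \<phi> where "\<phi> = \<psi> \<cdot> \<eta> K"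
  have \<phi>: "\<phi> \<in> Arr C" "Dom C \<phi> = K" "Cod C \<phi> = L" using \<psi> O by (simp_all add: \<phi>_def)
  have l\<phi>: "l \<cdot> \<phi> = \<eta> A \<cdot> k"
    unfolding \<phi>_def nat_k[symmetric] by (rule comp_reassoc1[OF \<psi>(4)]) (use \<psi> lA O in simp_all)

  \<comment> \<open>If \<open>\<phi>\<close> kills \<open>g\<close>, then \<open>\<eta> A\<close>
    kills \<open>k \<cdot> g\<close>, which therefore factors through \<open>tA\<close> by some
    \<open>x\<close>. As \<open>f'\<close> kills \<open>x\<close>, it factors further through
    \<open>n\<close>, so \<open>g\<close> factors through the torsion object \<open>Dom C n\<close>
    and is killed by \<open>\<eta> K\<close>.\<close>
  have \<phi>_ker: "is_kernel C tK \<phi>"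
  proof (rule kernelI)
    have "is_zero_arrow C (\<psi> \<cdot> (\<eta> K \<cdot> tK))"
      by (rule zero_arrow_comp_left[OF kernelD(4)[OF tK(1)]]) (use \<psi> tKA O in simp_all)
    then show "is_zero_arrow C (\<phi> \<cdot> tK)" using \<psi> tKA O by (simp add: \<phi>_def)
    fix g assume g: "g \<in> Arr C" "Cod C g = Dom C \<phi>" "is_zero_arrow C (\<phi> \<cdot> g)"
    have gK: "Cod C g = K" using g \<phi> by simp
    have "is_zero_arrow C (l \<cdot> (\<phi> \<cdot> g))"
      by (rule zero_arrow_comp_left[OF g(3)]) (use g(1) gK \<phi> lA in simp_all)
    moreover have "l \<cdot> (\<phi> \<cdot> g) = \<eta> A \<cdot> (k \<cdot> g)"
      by (rule comp_reassoc[OF l\<phi>]) (use g(1) gK \<phi> lA kA O in simp_all)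
    ultimately have "is_zero_arrow C (\<eta> A \<cdot> (k \<cdot> g))" by simp
    then obtain x where x: "x \<in> Arr C" "Dom C x = Dom C g" "Cod C x = Dom C tA" "tA \<cdot> x = k \<cdot> g"
      using kernel_lift[OF tA(1), of "k \<cdot> g"] g(1) gK kA O by auto
    have "tB \<cdot> (f' \<cdot> x) = f \<cdot> (tA \<cdot> x)"
      by (rule comp_reassoc[OF f'(4)]) (use f' x f tAA tBA in simp_all)
    also have "\<dots> = (f \<cdot> k) \<cdot> g" unfolding x(4) using f kA g(1) gK by simp
    finally have "is_zero_arrow C (tB \<cdot> (f' \<cdot> x))"
      using zero_arrow_comp_right[OF fk, of g] g(1) gK f kA by simp
    then have "is_zero_arrow C (f' \<cdot> x)"
      by (rule mono_zero_cancel[OF kernel_is_mono[OF tB(1)]]) (use f' x in simp_all)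
    then obtain y where y: "y \<in> Arr C" "Dom C y = Dom C x" "Cod C y = Dom C n" "n \<cdot> y = x"
      using kernel_lift[OF n, of x] x f' by auto
    have "is_zero_arrow C (f \<cdot> (tA \<cdot> n))"
    proof -
      have "tB \<cdot> (f' \<cdot> n) = f \<cdot> (tA \<cdot> n)"
        by (rule comp_reassoc[OF f'(4)]) (use f' nA f tAA tBA in simp_all)
      moreover have "is_zero_arrow C (tB \<cdot> (f' \<cdot> n))"
        by (rule zero_arrow_comp_left[OF kernelD(4)[OF n]]) (use f' nA tBA in simp_all)
      ultimately show ?thesis by simp
    qed
    then obtain n' where n': "n' \<in> Arr C" "Dom C n' = Dom C n" "Cod C n' = K" "k \<cdot> n' = tA \<cdot> n"
      using kernel_lift[OF k, of "tA \<cdot> n"] nA tAA f kA by auto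
    have "k \<cdot> (n' \<cdot> y) = tA \<cdot> (n \<cdot> y)"
      by (rule comp_reassoc[OF n'(4)]) (use n' nA y tAA kA in simp_all)
    then have "k \<cdot> (n' \<cdot> y) = k \<cdot> g" unfolding y(4) x(4) .
    then have ny: "n' \<cdot> y = g"
      by (rule mono_cancel[OF kernel_is_mono[OF k]]) (use n' y x g(1) gK kA in simp_all)
    have "is_zero_arrow C (\<eta> K \<cdot> n')"
      by (rule zero_arrow_torsion) (use n' nT O in simp_all)
    then have "is_zero_arrow C ((\<eta> K \<cdot> n') \<cdot> y)"
      by (rule zero_arrow_comp_right) (use n' y O in simp_all)
    then have "is_zero_arrow C (\<eta> K \<cdot> g)" using n' y O by (simp add: ny)
    then show "\<exists>h. h \<in> Arr C \<and> Dom C h = Dom C g \<and> Cod C h = Dom C tK \<and> tK \<cdot> h = g"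
      using kernel_lift[OF tK(1), of g] g(1) gK O by simp
  qed (use tKA \<phi> kernel_is_mono[OF tK(1)] in simp_all)

  \<comment> \<open>Three arrows into this pullback follow: \<open>d\<close> with components
    \<open>\<eta> A\<close> and \<open>f\<close>, \<open>j\<close> with components \<open>l\<close>
    and zero, and \<open>c\<close> with components zero and \<open>tB\<close>. The last is the
    kernel of \<open>p\<close>.\<close>
  obtain p q where pb: "is_pullback C p q (FArr R f) (\<eta> B)"
    by (rule pullbacks[of "FArr R f" "\<eta> B"]) (use Ff O in simp_all)
  define P where "P = Dom C p"
  have p: "p \<in> Arr C" "Dom C p = P" "Cod C p = FObj R A"
    and q: "q \<in> Arr C" "Dom C q = P" "Cod C q = B"
    using pullbackD(3,4,6-8)[OF pb] Ff O by (simp_all add: P_def)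
  obtain d where d: "d \<in> Arr C" "Dom C d = A" "Cod C d = P" "p \<cdot> d = \<eta> A" "q \<cdot> d = f"
    using pullback_lift[OF pb, of "\<eta> A" f] nat_f Ff f O p by auto
  obtain zL where zL: "zL \<in> Arr C" "Dom C zL = L" "Cod C zL = B" "is_zero_arrow C zL"
    using zero_arrow_exists[of L B] lA O by auto
  have "FArr R f \<cdot> l = \<eta> B \<cdot> zL"
    by (rule zero_arrow_unique[OF Fl zero_arrow_comp_left[OF zL(4)]]) (use zL lA Ff O in simp_all)
  then obtain j where j: "j \<in> Arr C" "Dom C j = L" "Cod C j = P" "p \<cdot> j = l" "q \<cdot> j = zL"
    using pullback_lift[OF pb, of l zL] zL lA Ff O p by auto
  obtain zB where zB: "zB \<in> Arr C" "Dom C zB = Dom C tB" "Cod C zB = FObj R A" "is_zero_arrow C zB"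
    using zero_arrow_exists[of "Dom C tB" "FObj R A"] tBA O by auto
  have "FArr R f \<cdot> zB = \<eta> B \<cdot> tB"
    by (rule zero_arrow_unique[OF zero_arrow_comp_left[OF zB(4)] kernelD(4)[OF tB(1)]])
      (use zB tBA Ff O in simp_all)
  then obtain c where c: "c \<in> Arr C" "Dom C c = Dom C tB" "Cod C c = P" "p \<cdot> c = zB" "q \<cdot> c = tB"
    using pullback_lift[OF pb, of zB tB] zB tBA Ff O p by auto
  have c_ker: "is_kernel C c p"
    by (rule kernel_of_pullback[OF pullback_swap[OF pb] tB(1)]) (use c zB q in simp_all)

  \<comment> \<open>To make \<open>d\<close> a regular epimorphism, its image \<open>m\<close> is
    shown to be invertible.\<close>
  obtain m e where m: "is_mono C m" and e: "is_regular_epi C e" and me: "Cod C e = Dom C m" "m \<cdot> e = d"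
    using factorisation[OF d(1)] by auto
  have mA: "m \<in> Arr C" using m by (simp add: is_mono_def)
  have eA: "e \<in> Arr C" by (rule regular_epi_arr[OF e])
  have De: "Dom C e = A" "Cod C m = P" using comp_arr(2,3)[OF eA mA me(1)] me(2) d by simp_all
  \<comment> \<open>\<open>tA \<cdot> s'\<close> lifts \<open>c\<close> along \<open>d\<close>:
    composing it with \<open>\<eta> A\<close> gives zero, and composing it with \<open>f\<close>
    gives \<open>tB\<close>. So the kernel \<open>c\<close> of \<open>p\<close> lies in the image
    \<open>m\<close>.\<close>
  let ?c' = "e \<cdot> (tA \<cdot> s')"
  have mc': "m \<cdot> ?c' = c"
  proof (rule pullback_unique[OF pb])
    have eq: "m \<cdot> ?c' = d \<cdot> (tA \<cdot> s')"
      by (rule comp_reassoc1[OF me(2)]) (use mA eA me De tAA s'(1-3) in simp_all)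
    have pd: "p \<cdot> (d \<cdot> (tA \<cdot> s')) = \<eta> A \<cdot> (tA \<cdot> s')"
      by (rule comp_reassoc1[OF d(4)]) (use p d tAA s'(1-3) in simp_all)
    have "is_zero_arrow C ((\<eta> A \<cdot> tA) \<cdot> s')"
      by (rule zero_arrow_comp_right[OF kernelD(4)[OF tA(1)]]) (use tAA s'(1-3) O in simp_all)
    then have "is_zero_arrow C (\<eta> A \<cdot> (tA \<cdot> s'))" using tAA s'(1-3) O by simp
    then show "p \<cdot> (m \<cdot> ?c') = p \<cdot> c"
      unfolding eq pd c(4) by (rule zero_arrow_unique[OF _ zB(4)]) (use zB s'(1-3) tAA O in simp_all)
    have "q \<cdot> (d \<cdot> (tA \<cdot> s')) = f \<cdot> (tA \<cdot> s')"
      by (rule comp_reassoc1[OF d(5)]) (use q d tAA s'(1-3) in simp_all)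
    then show "q \<cdot> (m \<cdot> ?c') = q \<cdot> c" unfolding eq c(5) ftAs .
  qed (use mA eA me De tAA s'(1-3) c p in simp_all)
  have "is_iso C m"
  proof (rule mono_iso_if_same_kernel[OF m])
    show "is_regular_epi C (p \<cdot> (m \<cdot> e))" unfolding me(2) d(4) by (rule regA)
    show "is_kernel C (m \<cdot> ?c') p" unfolding mc' by (rule c_ker)
  qed (use p De eA me tAA s'(1-3) in simp_all)
  then have d_reg: "is_regular_epi C d"
    using regular_epi_comp_iso[OF e _ me(1)] me(2) by simp

  \<comment> \<open>If \<open>d \<cdot> a = j \<cdot> b\<close>, then \<open>f \<cdot> a\<close>
    equals the zero arrow \<open>zL \<cdot> b\<close>, so \<open>a\<close> factors through
    \<open>k\<close> by some \<open>x\<close>; cancelling \<open>l\<close> gives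
    \<open>\<phi> \<cdot> x = b\<close>. Thus \<open>\<phi>\<close> is a pullback of the regular
    epimorphism \<open>d\<close>.\<close>
  have "is_pullback C k \<phi> d j"
  proof (rule pullbackI)
    have pd: "p \<cdot> (d \<cdot> x) = \<eta> A \<cdot> x" "q \<cdot> (d \<cdot> x) = f \<cdot> x" if "x \<in> Arr C" "Cod C x = A" for x
      using comp_reassoc1[OF d(4) d(1) p(1)] comp_reassoc1[OF d(5) d(1) q(1)] that d p q by simp_all
    have pj: "p \<cdot> (j \<cdot> x) = l \<cdot> x" "q \<cdot> (j \<cdot> x) = zL \<cdot> x" if "x \<in> Arr C" "Cod C x = L" for x
      using comp_reassoc1[OF j(4) j(1) p(1)] comp_reassoc1[OF j(5) j(1) q(1)] that j p q by simp_all
    have zx: "is_zero_arrow C (zL \<cdot> x)" if "x \<in> Arr C" "Cod C x = L" for x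
      by (rule zero_arrow_comp_right[OF zL(4)]) (use that zL in simp_all)
    show "d \<cdot> k = j \<cdot> \<phi>"
    proof (rule pullback_unique[OF pb])
      show "p \<cdot> (d \<cdot> k) = p \<cdot> (j \<cdot> \<phi>)" using pd(1)[of k] pj(1)[of \<phi>] l\<phi> kA \<phi> by simp
      have "f \<cdot> k = zL \<cdot> \<phi>"
        by (rule zero_arrow_unique[OF fk zx]) (use kA \<phi> f zL in simp_all)
      then show "q \<cdot> (d \<cdot> k) = q \<cdot> (j \<cdot> \<phi>)" using pd(2)[of k] pj(2)[of \<phi>] kA \<phi> by simp
    qed (use d j kA \<phi> p in simp_all)
    fix a b assume "a \<in> Arr C" "b \<in> Arr C" "Cod C a = Dom C d" "Cod C b = Dom C j"
      "Dom C a = Dom C b" and dj: "d \<cdot> a = j \<cdot> b"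
    then have ab: "a \<in> Arr C" "b \<in> Arr C" "Cod C a = A" "Cod C b = L" "Dom C a = Dom C b"
      using d j by simp_all
    have \<eta>a: "\<eta> A \<cdot> a = l \<cdot> b" and fa: "f \<cdot> a = zL \<cdot> b"
      using pd[OF ab(1,3)] pj[OF ab(2,4)] dj by simp_all
    have "is_zero_arrow C (f \<cdot> a)" unfolding fa by (rule zx[OF ab(2,4)])
    then obtain x where x: "x \<in> Arr C" "Dom C x = Dom C a" "Cod C x = K" "k \<cdot> x = a"
      using kernel_lift[OF k, of a] ab(1,3) f kA by auto
    have "l \<cdot> (\<phi> \<cdot> x) = \<eta> A \<cdot> (k \<cdot> x)"
      by (rule comp_reassoc[OF l\<phi>]) (use x lA \<phi> kA O in simp_all)
    then have "l \<cdot> (\<phi> \<cdot> x) = l \<cdot> b" unfolding x(4) \<eta>a .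
    then have \<phi>x: "\<phi> \<cdot> x = b"
      by (rule mono_cancel[OF l_mono]) (use x lA \<phi> ab(1-4) ab(5) in simp_all)
    show "\<exists>!h. h \<in> Hom C (Dom C a) (Dom C k) \<and> k \<cdot> h = a \<and> \<phi> \<cdot> h = b"
    proof (rule ex1I[of _ x])
      show "x \<in> Hom C (Dom C a) (Dom C k) \<and> k \<cdot> x = a \<and> \<phi> \<cdot> x = b"
        using x kA \<phi>x by (simp add: Hom_def)
      fix h assume h: "h \<in> Hom C (Dom C a) (Dom C k) \<and> k \<cdot> h = a \<and> \<phi> \<cdot> h = b"
      then have "k \<cdot> h = k \<cdot> x" using x(4) by simp
      then show "h = x"
        by (rule mono_cancel[OF kernel_is_mono[OF k]]) (use h x(1-3) kA in \<open>simp_all add: Hom_def\<close>)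
    qed
  qed (use d j kA \<phi> in simp_all)
  then have \<phi>_reg: "is_regular_epi C \<phi>" by (rule regular_epi_pullback[OF d_reg])

  \<comment> \<open>\<open>\<phi> = \<psi> \<cdot> \<eta> K\<close> and \<open>\<eta> K\<close> have
    the common kernel \<open>tK\<close>, so \<open>\<eta> K\<close> factors through
    \<open>\<phi>\<close>, and the factor \<open>h\<close> is inverse to
    \<open>\<psi>\<close>.\<close>
  obtain h where h: "h \<in> Arr C" "Dom C h = L" "Cod C h = FObj R K" "h \<cdot> \<phi> = \<eta> K"
    using factor_through_regular_epi[of "\<eta> K" \<psi> tK] \<phi>_reg \<phi>_ker tK(1) \<psi> O
    by (auto simp flip: \<phi>_def)
  have "\<psi> \<cdot> (h \<cdot> \<phi>) = Id C L \<cdot> \<phi>" unfolding h(4) using \<phi> by (simp add: \<phi>_def)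
  then have \<psi>h: "\<psi> \<cdot> h = Id C L"
    using regular_epi_cancel[OF \<phi>_reg, of "\<psi> \<cdot> h" "Id C L"] \<psi> h \<phi> lA by auto
  have h\<psi>: "h \<cdot> \<psi> = Id C (FObj R K)"
    by (rule unit_cancel[OF O(3)]) (use h \<psi> O in \<open>simp_all add: \<phi>_def\<close>)
  show ?thesis
  proof (rule kernelI)
    show "is_zero_arrow C (FArr R f \<cdot> FArr R k)" by fact
    have l\<psi>: "l \<cdot> (\<psi> \<cdot> x) = FArr R k \<cdot> x" if "x \<in> Arr C" "Cod C x = FObj R K" for x
      by (rule comp_reassoc1[OF \<psi>(4)]) (use that \<psi> lA in simp_all)
    show "is_mono C (FArr R k)"
      unfolding is_mono_def
    proof (intro conjI allI ballI impI)
      fix X x y assume "x \<in> Hom C X (Dom C (FArr R k))" "y \<in> Hom C X (Dom C (FArr R k))"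
        and eq: "FArr R k \<cdot> x = FArr R k \<cdot> y"
      then have xy: "x \<in> Arr C" "y \<in> Arr C" "Cod C x = FObj R K" "Cod C y = FObj R K" "Dom C x = X" "Dom C y = X"
        using Fk by (simp_all add: Hom_def)
      have "l \<cdot> (\<psi> \<cdot> x) = l \<cdot> (\<psi> \<cdot> y)" using l\<psi> xy eq by simp
      then have "\<psi> \<cdot> x = \<psi> \<cdot> y"
        by (rule mono_cancel[OF l_mono]) (use xy \<psi> lA in simp_all)
      then have "h \<cdot> (\<psi> \<cdot> x) = h \<cdot> (\<psi> \<cdot> y)" by simp
      then show "x = y"
        using comp_reassoc1[OF h\<psi>, of x] comp_reassoc1[OF h\<psi>, of y] xy \<psi> h by simp
    qed (rule Fk)
    fix g assume g: "g \<in> Arr C" "Cod C g = Dom C (FArr R f)" "is_zero_arrow C (FArr R f \<cdot> g)"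
    obtain y where y: "y \<in> Arr C" "Dom C y = Dom C g" "Cod C y = L" "l \<cdot> y = g"
      using kernel_lift[OF l g] lA by auto
    have "FArr R k \<cdot> (h \<cdot> y) = l \<cdot> (\<psi> \<cdot> (h \<cdot> y))" using l\<psi>[of "h \<cdot> y"] h y by simp
    also have "\<psi> \<cdot> (h \<cdot> y) = y" using comp_reassoc1[OF \<psi>h, of y] h y \<psi> by simp
    finally have "FArr R k \<cdot> (h \<cdot> y) = g" using y(4) by simp
    then show "\<exists>x. x \<in> Arr C \<and> Dom C x = Dom C g \<and> Cod C x = Dom C (FArr R k) \<and> FArr R k \<cdot> x = g"
      using h y Fk by (intro exI[of _ "h \<cdot> y"]) simp
  qed (use Fk Ff in simp_all)
qed

section \<open>Heredity implies protoadditivity\<close>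

text \<open>Functoriality alone preserves the section. The kernel passes from \<open>C\<close> to
  the subcategory because a zero object is torsion-free.\<close>

lemma protoadditive_if_hereditary:
  assumes her: "hereditary C (protosplit_monos C) \<T>"
  shows "protoadditive C (full_subcategory C \<F>) R"
  unfolding protoadditive_def split_short_exact_def
proof (intro allI impI conjI; elim conjE)
  fix k f s assume k: "is_kernel C k f" and s: "is_section_of C s f"
  note K = kernelD[OF k]
  have S: "s \<in> Arr C" "Dom C s = Cod C f" "Cod C s = Dom C f" "f \<cdot> s = Id C (Cod C f)"
    using s K(2) unfolding is_section_of_def by (simp_all add: Hom_def)
  obtain Z where Z: "is_zero_object C Z" using zero_object_exists by blast
  show "is_kernel (full_subcategory C \<F>) (FArr R k) (FArr R f)"
    by (rule kernel_full_subcategory[OF torsion_free_Obj zero_object_torsion_free[OF Z] Z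
        reflection_kernel[OF her k s]]) (use K(1-3) in simp_all)
  have "FArr R f \<cdot> FArr R s = Id C (FObj R (Cod C f))"
    using FArr_comp[of s f] FArr_Id[of "Cod C f"] S K(2) by simp
  then show "is_section_of (full_subcategory C \<F>) (FArr R s) (FArr R f)"
    unfolding is_section_of_def using S(1-3) K(2) by (simp add: full_subcategory_simps Hom_def)
qed

end

section \<open>Equivalence of heredity and protoadditivity\<close>

theorem theorem2p6:
  fixes C :: "('o, 'a, 'x) precategory_scheme"
    and \<T> \<F> :: "'o set"
    and F :: "('o, 'a, 'o, 'a) prefunctor"
  assumes "homological_category C"
    and "torsion_theory C \<T> \<F>"
    and "reflector C \<F> F"
  shows "hereditary C (protosplit_monos C) \<T>
           \<longleftrightarrow> protoadditive C (full_subcategory C \<F>) F"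
proof -
  obtain \<eta> where functorial: "is_functor C (full_subcategory C \<F>) F"
    and \<eta>: "\<forall>A \<in> Obj C. \<eta> A \<in> Hom C A (FObj F A)"
      "\<forall>A B. \<forall>f \<in> Hom C A B. FArr F f \<cdot>\<^bsub>C\<^esub> \<eta> A = \<eta> B \<cdot>\<^bsub>C\<^esub> f"
      "\<forall>A \<in> Obj C. \<forall>X \<in> \<F>. \<forall>f \<in> Hom C A X.
         \<exists>!h. h \<in> Hom C (FObj F A) X \<and> h \<cdot>\<^bsub>C\<^esub> \<eta> A = f"
    using assms(3) unfolding reflector_def by (elim conjE exE) (rule that)
  interpret homological_category C by fact
  interpret torsion_reflection C \<T> \<F> F \<eta>
    by unfold_locales (use assms(2) functorial \<eta> in simp_all)
  show ?thesis using hereditary_if_protoadditive protoadditive_if_hereditary by blast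
qed

end
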